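(* Assume that $\phi$ is a spherically symmetric solution to $\Box_g\phi=0$ on $\mathcal R$ whose initial data satisfy the data bounds with constant $D>0$. If $\phi$ satisfies the following $L^2$ upper bound on the event horizon: $$\int_{\mathcal H^+\cap\{v\ge1\}}v^{7+\epsilon}(\partial_v\phi)^2=A<\infty$$ for some $A>0$ and $\epsilon>0$, then for every $R\ge r_+$ the following upper bounds hold in the exterior (up to and including $\mathcal H^+$): $$\sup_{\{r_+\le r\le R\}\cap\{v\ge1\}}v^{3+\frac\epsilon2}|\phi|\le C\qquad\text{and}\qquad\int_{\{r=R,\ v\ge1\}}v^5(\partial_v(r\phi))^2\le C$$ for some $C=C(A,R,D,\epsilon)>0$.
   Context: Fix $0<|e|<M$, let $r_\pm=M\pm\sqrt{M^2-e^2}$, $F(r)=1-\frac{2M}{r}+\frac{e^2}{r^2}$. On the exterior region $\{r>r_+\}$ and on the black hole interior $\{r_-<r<r_+\}$ the Reissner–Nordström metric is $g=-F\,dt^2+F^{-1}dr^2+r^2d\sigma_{\mathbb S^2}$. Put $r^*=r+\big(M+\frac{2M^2-e^2}{2\sqrt{M^2-e^2}}\big)\log|r-r_+|+\big(M-\frac{2M^2-e^2}{2\sqrt{M^2-e^2}}\big)\log|r-r_-|$. Exterior null coordinates: $v=\frac12(t+r^* )$, $u=\frac12(t-r^* )$, $\Omega^2=F$, $\partial_v r=-\partial_u r=\Omega^2$; future null infinity is $\{v=\infty\}$, the event horizon $\mathcal H^+$ is $\{u=+\infty\}$. Interior null coordinates: $v=\frac12(r^*+t)$, $u=\frac12(r^*-t)$,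 $\Omega^2=-F$, $\partial_v r=\partial_u r=-\Omega^2$; $\mathcal H^+$ is $\{u=-\infty\}$. In both regions $g=-4\Omega^2du\,dv+r^2d\sigma_{\mathbb S^2}$. The two regions are glued smoothly along $\mathcal H^+=\{r=r_+\}$ using coordinates $(v,r)$, in which $g=-4F\,dv^2+4\,dv\,dr+r^2d\sigma_{\mathbb S^2}$. For spherically symmetric $\phi$, $\Box_g\phi=0$ reads $\partial_u\partial_v\phi=-\frac{\partial_v r\,\partial_u\phi}{r}-\frac{\partial_u r\,\partial_v\phi}{r}$. Solutions are real-valued, $C^1$ (including across $\mathcal H^+$), with continuous $\partial_u\partial_v\phi$. $U_0>0$ is fixed throughout (constants may depend on $M$, $e$, $U_0$). $\mathcal R$ is the union of the exterior set $\{u\ge -U_0,\ v\ge1\}$, $\mathcal H^+\cap\{v\ge1\}$, and the interior set $\{u\le-1,\ v\ge1\}$; suprema and integrals are over the parts of the indicated sets lying in $\mathcal R$. Data bounds with constant $D$: on the exterior hypersurface $\{u=-U_0,\ v\ge1\}$, $r^2\big|\frac{\partial_v\phi}{\partial_v r}\big|\le D$ and $r^3\big|\frac{\partial_v(r\phi)}{\partial_v r}\big|\le D$; on the hypersurface $\{v=1\}$, restricted to $u\ge -U_0$ in the exterior and $u\le -1$ in the interior, $\big|\frac{\partial_u\phi}{\partial_u r}\big|\le D$ and $\big|\frac{\partial_u(r\phi)}{\partial_u r}\big|\le D$. Integrals over $\mathcal H^+$ and over $\{r=R\}$ are with respect to $dv$ (curves parametrized by $v$); $\partial_v$ denotes the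 null-coordinate derivative (at fixed $u$), on $\mathcal H^+$ its limit as $u\to\infty$. *)

theory Defs
  imports "HOL-Analysis.Analysis"
begin

definition r_plus :: "real \<Rightarrow> real \<Rightarrow> real" where
  "r_plus M e = M + sqrt (M\<^sup>2 - e\<^sup>2)"

definition r_minus :: "real \<Rightarrow> real \<Rightarrow> real" where
  "r_minus M e = M - sqrt (M\<^sup>2 - e\<^sup>2)"

definition r_star :: "real \<Rightarrow> real \<Rightarrow> real \<Rightarrow> real" where
  "r_star M e r = r
     + (M + (2 * M\<^sup>2 - e\<^sup>2) / (2 * sqrt (M\<^sup>2 - e\<^sup>2))) * ln \<bar>r - r_plus M e\<bar>
     + (M - (2 * M\<^sup>2 - e\<^sup>2) / (2 * sqrt (M\<^sup>2 - e\<^sup>2))) * ln \<bar>r - r_minus M e\<bar>"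

text \<open>
  Spherically symmetric functions are functions of the coordinates (v, r), which are regular
  across the event horizon r = r_+. The null coordinate u is v - r* in the exterior and
  r* - v in the interior.
\<close>

definition region :: "real \<Rightarrow> real \<Rightarrow> real \<Rightarrow> (real \<times> real) set" where
  "region M e U0 =
     {(v, r). v \<ge> 1 \<and> r > r_plus M e \<and> v - r_star M e r \<ge> - U0} \<union>
     {(v, r). v \<ge> 1 \<and> r = r_plus M e} \<union>
     {(v, r). v \<ge> 1 \<and> r_minus M e < r \<and> r < r_plus M e \<and> r_star M e r - v \<le> - 1}"

definition r_ext :: "real \<Rightarrow> real \<Rightarrow> real \<Rightarrow> real \<Rightarrow> real" where
  "r_ext M e u v = the_inv_into {r_plus M e<..} (r_star M e) (v - u)"

definition r_int :: "real \<Rightarrow> real \<Rightarrow> real \<Rightarrow> real \<Rightarrow> real" where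
  "r_int M e u v = the_inv_into {r_minus M e<..<r_plus M e} (r_star M e) (u + v)"

text \<open>Expressions of a function of (v, r) in the null coordinates (u, v) of either region.\<close>

definition ext_null :: "real \<Rightarrow> real \<Rightarrow> (real \<times> real \<Rightarrow> real) \<Rightarrow> real \<Rightarrow> real \<Rightarrow> real" where
  "ext_null M e f u v = f (v, r_ext M e u v)"

definition int_null :: "real \<Rightarrow> real \<Rightarrow> (real \<times> real \<Rightarrow> real) \<Rightarrow> real \<Rightarrow> real \<Rightarrow> real" where
  "int_null M e f u v = f (v, r_int M e u v)"

text \<open>
  Null-coordinate derivatives on a product domain U \<times> {1..}, one-sided at its boundary.
  Here U is {-U0..} in the exterior and {..-1} in the interior.
\<close>

definition d_v :: "(real \<Rightarrow> real \<Rightarrow> real) \<Rightarrow> real \<Rightarrow> real \<Rightarrow> real" where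
  "d_v f u v = vector_derivative (\<lambda>v'. f u v') (at v within {1..})"

definition d_u :: "real set \<Rightarrow> (real \<Rightarrow> real \<Rightarrow> real) \<Rightarrow> real \<Rightarrow> real \<Rightarrow> real" where
  "d_u U f u v = vector_derivative (\<lambda>u'. f u' v) (at u within U)"

definition wave_eq_on ::
  "real set \<Rightarrow> (real \<Rightarrow> real \<Rightarrow> real) \<Rightarrow> (real \<Rightarrow> real \<Rightarrow> real) \<Rightarrow> bool" where
  "wave_eq_on U r \<psi> \<longleftrightarrow>
     (\<forall>u\<in>U. \<forall>v\<ge>1.
        (\<lambda>u'. d_v \<psi> u' v) differentiable (at u within U) \<and>
        d_u U (d_v \<psi>) u v = - (d_v r u v * d_u U \<psi> u v / r u v) - d_u U r u v * d_v \<psi> u v / r u v) \<and>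
     continuous_on (U \<times> {1..}) (\<lambda>(u, v). d_u U (d_v \<psi>) u v)"

definition C1_on :: "(real \<times> real) set \<Rightarrow> (real \<times> real \<Rightarrow> real) \<Rightarrow> bool" where
  "C1_on S f \<longleftrightarrow> (\<exists>f' :: real \<times> real \<Rightarrow> (real \<times> real) \<Rightarrow>\<^sub>L real.
     (\<forall>p\<in>S. (f has_derivative blinfun_apply (f' p)) (at p within S)) \<and> continuous_on S f')"

text \<open>
  No separate equation is imposed on the horizon: C1 regularity in (v, r) across r = r_+
  and the equation on both sides imply it there by continuity.
\<close>

definition is_solution :: "real \<Rightarrow> real \<Rightarrow> real \<Rightarrow> (real \<times> real \<Rightarrow> real) \<Rightarrow> bool" where
  "is_solution M e U0 \<phi> \<longleftrightarrow>
     C1_on (region M e U0) \<phi> \<and>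
     wave_eq_on {- U0..} (r_ext M e) (ext_null M e \<phi>) \<and>
     wave_eq_on {..- 1} (r_int M e) (int_null M e \<phi>)"

definition times_r :: "(real \<times> real \<Rightarrow> real) \<Rightarrow> real \<times> real \<Rightarrow> real" where
  "times_r \<phi> = (\<lambda>(v, r). r * \<phi> (v, r))"

definition data_bounds :: "real \<Rightarrow> real \<Rightarrow> real \<Rightarrow> real \<Rightarrow> (real \<times> real \<Rightarrow> real) \<Rightarrow> bool" where
  "data_bounds M e U0 D \<phi> \<longleftrightarrow>
     (\<forall>v\<ge>1.
        (r_ext M e (- U0) v)^2 *
          \<bar>d_v (ext_null M e \<phi>) (- U0) v / d_v (r_ext M e) (- U0) v\<bar> \<le> D \<and>
        (r_ext M e (- U0) v)^3 *
          \<bar>d_v (ext_null M e (times_r \<phi>)) (- U0) v / d_v (r_ext M e) (- U0) v\<bar> \<le> D) \<and>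
     (\<forall>u\<ge>- U0.
        \<bar>d_u {- U0..} (ext_null M e \<phi>) u 1 / d_u {- U0..} (r_ext M e) u 1\<bar> \<le> D \<and>
        \<bar>d_u {- U0..} (ext_null M e (times_r \<phi>)) u 1 / d_u {- U0..} (r_ext M e) u 1\<bar> \<le> D) \<and>
     (\<forall>u\<le>- 1.
        \<bar>d_u {..- 1} (int_null M e \<phi>) u 1 / d_u {..- 1} (r_int M e) u 1\<bar> \<le> D \<and>
        \<bar>d_u {..- 1} (int_null M e (times_r \<phi>)) u 1 / d_u {..- 1} (r_int M e) u 1\<bar> \<le> D)"

text \<open>
  The derivative in v at fixed u, at the point (v, r) of the closed exterior; on the
  horizon it is the limit as u tends to infinity.
\<close>

definition d_v_at :: "real \<Rightarrow> real \<Rightarrow> (real \<times> real \<Rightarrow> real) \<Rightarrow> real \<Rightarrow> real \<Rightarrow> real" where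
  "d_v_at M e f v r =
     (if r > r_plus M e then d_v (ext_null M e f) (v - r_star M e r) v
      else Lim at_top (\<lambda>u. d_v (ext_null M e f) u v))"

end

(*
  Write X for d_r phi at fixed v, Y for d_v phi at fixed u, W = d_r(r phi) and F' for dF/dr. At
  fixed u one has d_v W = F' (phi - W), a transport equation damped by the red-shift F' > 0. It
  is solved forwards in v from the data on v = 1 and coupled with d_r(r phi) = W, solved outwards
  from the horizon, so a maximum principle carries weighted pointwise bounds from the horizon
  to r <= R. The horizon flux bound makes phi converge along the horizon, at the rate
  v^(-3 - epsilon/2), to some c, hence also along every curve of constant r. The energy identity
  d_u(r^2 Y^2) + d_v(r^2 (d_u phi)^2) = 0 and the data at null infinity give phi = O(r^(-1/2)),
  so c = 0. The flux through r = R follows from d_r(d_v(r phi)) = F' phi at fixed v.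
*)
theory Submission
  imports Defs
begin

text \<open>The horizon flux sees phi only up to a constant, and constants solve the equation; the
  decay imposed on d_v(r phi) at large r excludes them. So the propagation estimate is stated for
  phi - c with c arbitrary and applied twice: with the unknown limit c, where its constants may
  depend on c and R because only v -> infinity at fixed R matters, and again once c = 0 is known,
  which leaves only A, R, D, epsilon, M and e in the constants. The energy serves only to show c =
  0. W is preferred to X because its transport equation contains no Y, so that the pair (phi, W) is
  closed. The red-shift F' tends to 0 at large r; the weight is therefore (v + K)^p with K large in
  terms of R, which keeps its logarithmic derivative below half of F' on r <= R. The exponents: for
  q = 7 + epsilon, Cauchy-Schwarz gives the rate (q - 1)/2 = 3 + epsilon/2 on the horizon, and v^5
  times the squared rate is v^(-1 - epsilon), which is integrable.\<close>

section \<open>Real analysis\<close>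

lemma at_within_atLeast_neq_bot: "(a::real) \<le> x \<Longrightarrow> at x within {a..} \<noteq> bot"
proof -
  assume "a \<le> x"
  then have "at_right x \<le> at x within {a..}" by (intro at_le) auto
  then show ?thesis by (metis bot.extremum_uniqueI trivial_limit_at_right_real)
qed

lemma vector_derivative_within_atLeast:
  fixes f :: "real \<Rightarrow> real"
  assumes "(f has_real_derivative D) (at x within {a..})" "a \<le> x"
  shows "vector_derivative f (at x within {a..}) = D"
  using assms by (intro vector_derivative_within at_within_atLeast_neq_bot)
    (simp_all add: has_real_derivative_iff_has_vector_derivative)

lemma has_real_derivative_unique_within_atLeast:
  fixes f :: "real \<Rightarrow> real"
  assumes "(f has_real_derivative D) (at x within {a..})" "(f has_real_derivative D') (at x within {a..})"
    "a \<le> x"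
  shows "D = D'"
  using vector_derivative_within_atLeast assms by metis

lemma at_within_atLeast_eq_Icc: "(b::real) < c \<Longrightarrow> x < c \<Longrightarrow> at x within {b..c} = at x within {b..}"
  by (rule at_within_nhd[of x "{..<c}"]) auto

text \<open>The wave equation provides d_u of d_v phi; this turns it into d_v of d_u phi, whose
  existence is not given. Integrating \<open>p\<close> in v and differentiating in u under the
  integral sign writes \<open>q\<close> as its value at b plus the integral of \<open>g\<close>, and
  the v-derivative of that is \<open>g\<close>. Derivatives are one-sided at the edges of the
  quadrant.\<close>

lemma mixed_partials_commute:
  fixes \<psi> p q g :: "real \<Rightarrow> real \<Rightarrow> real"
  assumes p: "\<And>u v. a \<le> u \<Longrightarrow> b \<le> v \<Longrightarrow> ((\<lambda>v. \<psi> u v) has_real_derivative p u v) (at v within {b..})"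
    and q: "\<And>u v. a \<le> u \<Longrightarrow> b \<le> v \<Longrightarrow> ((\<lambda>u. \<psi> u v) has_real_derivative q u v) (at u within {a..})"
    and g: "\<And>u v. a \<le> u \<Longrightarrow> b \<le> v \<Longrightarrow> ((\<lambda>u. p u v) has_real_derivative g u v) (at u within {a..})"
    and contp: "\<And>u. a \<le> u \<Longrightarrow> continuous_on {b..} (p u)"
    and contg: "continuous_on ({a..} \<times> {b..}) (\<lambda>(u, v). g u v)"
    and uv: "a \<le> u" "b \<le> v"
  shows "((\<lambda>v. q u v) has_real_derivative g u v) (at v within {b..})"
proof -
  have int_p: "integral {b..v} (p u) = \<psi> u v - \<psi> u b" if "a \<le> u" "b \<le> v" for u v
    using that p by (intro integral_unique fundamental_theorem_of_calculus)
      (auto simp flip: has_real_derivative_iff_has_vector_derivative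
         intro: has_field_derivative_subset[of _ _ _ "{b..}"])
  have contgu: "continuous_on {b..} (g u)"
    using uv by (intro continuous_on_compose2[OF contg, of _ "\<lambda>v. (u, v)", simplified] continuous_intros) auto
  have int_g: "q u v = q u b + integral {b..v} (g u)" if v: "b \<le> v" for v
  proof -
    have "((\<lambda>u. integral (cbox b v) (p u)) has_real_derivative integral (cbox b v) (g u)) (at u within {a..})"
      using g contp uv
      by (intro leibniz_rule_field_derivative)
        (auto intro!: integrable_continuous_real intro: continuous_on_subset[OF contp] continuous_on_subset[OF contg])
    then have "((\<lambda>u. integral {b..v} (p u)) has_real_derivative integral {b..v} (g u)) (at u within {a..})"
      by simp
    then have "((\<lambda>u. \<psi> u v - \<psi> u b) has_real_derivative integral {b..v} (g u)) (at u within {a..})"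
      by (rule has_field_derivative_transform_within[where d = 1]) (use uv v int_p in auto)
    moreover have "((\<lambda>u. \<psi> u v - \<psi> u b) has_real_derivative q u v - q u b) (at u within {a..})"
      using q uv v by (auto intro!: derivative_intros)
    ultimately show ?thesis
      using has_real_derivative_unique_within_atLeast uv by fastforce
  qed
  have "((\<lambda>v. q u b + integral {b..v} (g u)) has_real_derivative 0 + g u v) (at v within {b..v + 1})"
    using contgu uv by (intro DERIV_add DERIV_const integral_has_real_derivative)
      (auto intro: continuous_on_subset)
  then have "((\<lambda>v. q u b + integral {b..v} (g u)) has_real_derivative g u v) (at v within {b..v + 1})"
    by simp
  then have "((\<lambda>v. q u v) has_real_derivative g u v) (at v within {b..v + 1})"
    by (rule has_field_derivative_transform_within[where d = 1]) (use uv in \<open>auto simp flip: int_g\<close>)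
  then show ?thesis using uv at_within_atLeast_eq_Icc[of b "v + 1" v] by simp
qed

text \<open>Green's identity on a rectangle for the closed form A dv - B du: integrating
  \<open>k\<close> in the two possible orders expresses the same double integral by the fluxes of A
  and by those of B.\<close>

lemma conserved_flux_identity:
  fixes A B k :: "real \<Rightarrow> real \<Rightarrow> real"
  assumes A: "\<And>u v. u \<in> {u0..u1} \<Longrightarrow> v \<in> {v0..v1} \<Longrightarrow>
        ((\<lambda>u. A u v) has_real_derivative - k u v) (at u within {u0..u1})"
    and B: "\<And>u v. u \<in> {u0..u1} \<Longrightarrow> v \<in> {v0..v1} \<Longrightarrow>
        ((\<lambda>v. B u v) has_real_derivative k u v) (at v within {v0..v1})"
    and contk: "continuous_on ({u0..u1} \<times> {v0..v1}) (\<lambda>(u, v). k u v)"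
    and contA: "\<And>u. u \<in> {u0..u1} \<Longrightarrow> continuous_on {v0..v1} (A u)"
    and contB: "\<And>v. v \<in> {v0..v1} \<Longrightarrow> continuous_on {u0..u1} (\<lambda>u. B u v)"
    and le: "u0 \<le> u1" "v0 \<le> v1"
  shows "integral {v0..v1} (A u1) + integral {u0..u1} (\<lambda>u. B u v1)
    = integral {v0..v1} (A u0) + integral {u0..u1} (\<lambda>u. B u v0)"
proof -
  have "integral {u0..u1} (\<lambda>u. - k u v) = A u1 v - A u0 v" if "v \<in> {v0..v1}" for v
    using that A le by (intro integral_unique fundamental_theorem_of_calculus)
      (auto simp flip: has_real_derivative_iff_has_vector_derivative)
  then have kA: "integral {u0..u1} (\<lambda>u. k u v) = A u0 v - A u1 v" if "v \<in> {v0..v1}" for v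
    using that by fastforce
  have kB: "integral {v0..v1} (k u) = B u v1 - B u v0" if "u \<in> {u0..u1}" for u
    using that B le by (intro integral_unique fundamental_theorem_of_calculus)
      (auto simp flip: has_real_derivative_iff_has_vector_derivative)
  have "integral {v0..v1} (A u0) - integral {v0..v1} (A u1)
      = integral {v0..v1} (\<lambda>v. integral {u0..u1} (\<lambda>u. k u v))"
    using le contA kA by (subst integral_diff[symmetric])
      (auto intro!: integrable_continuous_real integral_cong)
  also have "\<dots> = integral {u0..u1} (\<lambda>u. integral {v0..v1} (k u))"
    using contk integral_swap_continuous[of u0 v0 u1 v1 k] by (simp add: cbox_Pair_eq)
  also have "\<dots> = integral {u0..u1} (\<lambda>u. B u v1) - integral {u0..u1} (\<lambda>u. B u v0)"
    using le contB kB by (subst integral_diff[symmetric])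
      (auto intro!: integrable_continuous_real integral_cong)
  finally show ?thesis by simp
qed

section \<open>Integral comparison, barriers and weighted tails\<close>

lemma integral_le_diff:
  fixes f g g' :: "real \<Rightarrow> real"
  assumes "a \<le> b" "continuous_on {a..b} f"
    and "\<And>x. x \<in> {a..b} \<Longrightarrow> (g has_real_derivative g' x) (at x within {a..b})"
    and "\<And>x. x \<in> {a..b} \<Longrightarrow> f x \<le> g' x"
  shows "integral {a..b} f \<le> g b - g a"
proof (rule has_integral_le)
  show "(f has_integral integral {a..b} f) {a..b}"
    using assms by (intro integrable_integral integrable_continuous_real)
  show "(g' has_integral g b - g a) {a..b}"
    using assms by (intro fundamental_theorem_of_calculus)
      (auto simp flip: has_real_derivative_iff_has_vector_derivative)
qed (use assms in auto)

lemma abs_diff_le_integral: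
  fixes f f' g :: "real \<Rightarrow> real"
  assumes "a \<le> b" "continuous_on {a..b} g"
    and "\<And>x. x \<in> {a..b} \<Longrightarrow> (f has_real_derivative f' x) (at x within {a..b})"
    and "\<And>x. x \<in> {a..b} \<Longrightarrow> \<bar>f' x\<bar> \<le> g x"
  shows "\<bar>f b - f a\<bar> \<le> integral {a..b} g"
proof -
  have f: "(f' has_integral f b - f a) {a..b}"
    using assms by (intro fundamental_theorem_of_calculus)
      (auto simp flip: has_real_derivative_iff_has_vector_derivative)
  have g: "(g has_integral integral {a..b} g) {a..b}"
    using assms by (intro integrable_integral integrable_continuous_real)
  have "f b - f a \<le> integral {a..b} g"
    using assms(4) by (intro has_integral_le[OF f g]) (simp add: abs_le_iff)
  moreover have "- (f b - f a) \<le> integral {a..b} g"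
    using assms(4) by (intro has_integral_le[OF has_integral_neg[OF f] g]) (simp add: abs_le_iff)
  ultimately show ?thesis by simp
qed

text \<open>Stands in for Cauchy-Schwarz under an integral: it is applied pointwise, with
  \<open>\<eta>\<close> fixed in advance at the value that balances the two resulting
  integrals.\<close>

lemma young_ineq:
  fixes x y \<eta> :: real
  assumes "0 < \<eta>" shows "\<bar>x * y\<bar> \<le> \<eta> / 2 * x\<^sup>2 + 1 / (2 * \<eta>) * y\<^sup>2"
proof -
  have "0 \<le> (\<eta> * \<bar>x\<bar> - \<bar>y\<bar>)\<^sup>2 / (2 * \<eta>)" using assms by simp
  also have "\<dots> = \<eta> / 2 * x\<^sup>2 + 1 / (2 * \<eta>) * y\<^sup>2 - \<bar>x * y\<bar>"
    using assms by (simp add: power2_diff power_mult_distrib abs_mult field_simps power2_eq_square)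
  finally show ?thesis by simp
qed

text \<open>After the last time s with y <= B the function stays above B, so y' <= 0 there and the
  mean value theorem gives y b <= y s. The sign of y' is required only where y exceeds B, which is
  what damping with a bounded forcing provides.\<close>

lemma upper_barrier:
  fixes y y' :: "real \<Rightarrow> real"
  assumes "a \<le> b"
    and deriv: "\<And>t. t \<in> {a..b} \<Longrightarrow> (y has_real_derivative y' t) (at t within {a..b})"
    and init: "y a \<le> B" and barrier: "\<And>t. t \<in> {a..b} \<Longrightarrow> B < y t \<Longrightarrow> y' t \<le> 0"
  shows "y b \<le> B"
proof (rule ccontr)
  assume "\<not> y b \<le> B"
  then have yb: "B < y b" by simp
  define S where "S = {t \<in> {a..b}. y t \<le> B}"
  have cont: "continuous_on {a..b} y"
    using DERIV_continuous_on deriv by blast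
  have "closed S" unfolding S_def
    using continuous_closed_preimage[OF cont, of "{..B}"] by (simp add: vimage_def Int_def)
  moreover have "bounded S"
    by (rule bounded_subset[OF bounded_closed_interval[of a b]]) (auto simp: S_def)
  moreover have "a \<in> S" using init \<open>a \<le> b\<close> by (simp add: S_def)
  ultimately have S: "compact S" "a \<in> S" by (auto simp: compact_eq_bounded_closed)
  then obtain s where s: "s \<in> S" "\<And>t. t \<in> S \<Longrightarrow> t \<le> s"
    using compact_attains_sup[of S] by auto
  then have s': "a \<le> s" "s < b" "y s \<le> B" using yb by (auto simp: S_def less_le)
  have "\<exists>z\<in>{s<..<b}. y b - y s = (b - s) * y' z"
  proof -
    have "(y has_derivative (\<lambda>h. h * y' z)) (at z within {s..b})" if "s \<le> z" "z \<le> b" for z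
      using that s' has_field_derivative_subset[OF deriv[of z], of "{s..b}"]
      by (auto simp: has_field_derivative_def mult_commute_abs)
    from mvt_simple[OF s'(2) this] show ?thesis by blast
  qed
  then obtain z where z: "z \<in> {s<..<b}" "y b - y s = (b - s) * y' z" by blast
  have "B < y z" using z s(2)[of z] s' by (force simp: S_def)
  then have "y' z \<le> 0" using z s' by (intro barrier) auto
  then have "(b - s) * y' z \<le> 0" using s' by (simp add: mult_nonneg_nonpos)
  then show False using z(2) yb s'(3) by linarith
qed

lemma damped_ode_bound:
  fixes y y' :: "real \<Rightarrow> real"
  assumes "a \<le> b"
    and deriv: "\<And>t. t \<in> {a..b} \<Longrightarrow> (y has_real_derivative y' t) (at t within {a..b})"
    and init: "\<bar>y a\<bar> \<le> B"
    and up: "\<And>t. t \<in> {a..b} \<Longrightarrow> B < y t \<Longrightarrow> y' t \<le> 0"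
    and down: "\<And>t. t \<in> {a..b} \<Longrightarrow> y t < - B \<Longrightarrow> 0 \<le> y' t"
  shows "\<bar>y b\<bar> \<le> B"
proof -
  have "y b \<le> B" using init by (intro upper_barrier[OF \<open>a \<le> b\<close> deriv _ up]) auto
  moreover have "- y b \<le> B"
    using init down by (intro upper_barrier[OF \<open>a \<le> b\<close> DERIV_minus[OF deriv]]) auto
  ultimately show ?thesis by simp
qed

text \<open>Write y as v^(q/2) y times v^(-q/2). The increments of f beyond a are then controlled by
  A and by the integral of v^(-q) beyond a; they are small for large a, so f converges, and letting
  the second endpoint tend to infinity keeps the rate.\<close>

lemma weighted_L2_tail:
  fixes f y :: "real \<Rightarrow> real" and A q :: real
  assumes q: "1 < q" and A: "0 \<le> A"
    and deriv: "\<And>v. 1 \<le> v \<Longrightarrow> (f has_real_derivative y v) (at v within {1..})"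
    and cont: "continuous_on {1..} y"
    and L2: "(\<integral>\<^sup>+v\<in>{1..}. ennreal (v powr q * (y v)\<^sup>2) \<partial>lborel) \<le> ennreal A"
  obtains c where "\<And>v. 1 \<le> v \<Longrightarrow> \<bar>f v - c\<bar> \<le> (A + 1 / (q - 1)) / 2 * v powr - ((q - 1) / 2)"
proof -
  define C where "C = (A + 1 / (q - 1)) / 2"
  define s where "s = (q - 1) / 2"
  have C: "0 < C" and s: "0 < s" using A q by (auto simp: C_def s_def add_nonneg_pos)
  have diff: "\<bar>f b - f a\<bar> \<le> C * a powr - s" if a: "1 \<le> a" and ab: "a \<le> b" for a b
  proof -
    \<comment> \<open>The integral of \<open>v powr - q\<close> beyond a is at most
      \<open>\<eta> * \<eta> / (q - 1)\<close>, so with this choice both Young terms are of order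
      \<open>\<eta>\<close>.\<close>
    define \<eta> where "\<eta> = a powr - s"
    have \<eta>: "0 < \<eta>" using a by (simp add: \<eta>_def)
    let ?g = "\<lambda>v. v powr q * (y v)\<^sup>2" and ?h = "\<lambda>v :: real. v powr - q"
    have contg: "continuous_on {a..b} ?g"
      using a by (intro continuous_intros continuous_on_subset[OF cont]) auto
    have conth: "continuous_on {a..b} ?h"
      using a by (intro continuous_intros) auto
    have "ennreal (integral {a..b} ?g) = (\<integral>\<^sup>+v\<in>{a..b}. ennreal (?g v) \<partial>lborel)"
      by (rule nn_integral_has_integral_lebesgue'[symmetric])
        (auto intro!: integrable_integral integrable_continuous_real contg)
    also have "\<dots> \<le> (\<integral>\<^sup>+v\<in>{1..}. ennreal (?g v) \<partial>lborel)"
      using a by (intro nn_integral_mono) (auto simp: indicator_def)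
    also note L2
    finally have intg: "integral {a..b} ?g \<le> A" using A by simp
    have inth: "integral {a..b} ?h \<le> a powr (1 - q) / (q - 1)"
    proof -
      have "integral {a..b} ?h \<le> - (b powr (1 - q)) / (q - 1) - - (a powr (1 - q)) / (q - 1)"
      proof (rule integral_le_diff[OF ab conth])
        show "((\<lambda>v. - (v powr (1 - q)) / (q - 1)) has_real_derivative ?h x) (at x within {a..b})"
          if "x \<in> {a..b}" for x
        proof -
          have "((\<lambda>v. - (v powr (1 - q)) / (q - 1)) has_real_derivative
              - ((1 - q) * x powr (1 - q - 1)) / (q - 1)) (at x within {a..b})"
            using that a q by (auto intro!: derivative_eq_intros)
          moreover have "- ((1 - q) * x powr (1 - q - 1)) / (q - 1) = x powr - q"
          proof -
            have "- ((1 - q) * x powr (1 - q - 1)) = (q - 1) * x powr - q"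
              by (simp add: algebra_simps)
            then show ?thesis using q by (simp add: nonzero_mult_div_cancel_left del: minus_mult_left)
          qed
          ultimately show ?thesis by (simp only:)
        qed
      qed simp
      also have "\<dots> \<le> a powr (1 - q) / (q - 1)" using q by simp
      finally show ?thesis .
    qed
    have "\<bar>f b - f a\<bar> \<le> integral {a..b} (\<lambda>v. \<eta> / 2 * ?g v + 1 / (2 * \<eta>) * ?h v)"
    proof (rule abs_diff_le_integral[OF ab])
      show "continuous_on {a..b} (\<lambda>v. \<eta> / 2 * ?g v + 1 / (2 * \<eta>) * ?h v)"
        by (intro continuous_intros contg conth)
      fix x assume x: "x \<in> {a..b}"
      show "(f has_real_derivative y x) (at x within {a..b})"
        using x a by (intro has_field_derivative_subset[OF deriv]) auto
      have "\<bar>(x powr (q / 2) * y x) * x powr - (q / 2)\<bar> \<le>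
          \<eta> / 2 * (x powr (q / 2) * y x)\<^sup>2 + 1 / (2 * \<eta>) * (x powr - (q / 2))\<^sup>2"
        by (rule young_ineq[OF \<eta>])
      moreover have "(x powr (q / 2) * y x) * x powr - (q / 2) = y x"
        using x a by (simp add: powr_minus field_simps)
      moreover have "(x powr (q / 2))\<^sup>2 = x powr q" "(x powr - (q / 2))\<^sup>2 = x powr - q"
        using x a by (simp_all add: power2_eq_square powr_add[symmetric])
      ultimately show "\<bar>y x\<bar> \<le> \<eta> / 2 * ?g x + 1 / (2 * \<eta>) * ?h x"
        by (simp only: power_mult_distrib)
    qed
    also have "\<dots> = \<eta> / 2 * integral {a..b} ?g + 1 / (2 * \<eta>) * integral {a..b} ?h"
      using integrable_continuous_real[OF contg] integrable_continuous_real[OF conth]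
      by (simp only: integral_add integrable_on_mult_right integral_mult_right)
    also have "\<dots> \<le> \<eta> / 2 * A + 1 / (2 * \<eta>) * (a powr (1 - q) / (q - 1))"
      using intg inth \<eta> by (intro add_mono mult_left_mono) auto
    also have "a powr (1 - q) = \<eta> * \<eta>"
      using a by (simp add: \<eta>_def s_def powr_add[symmetric])
    also have "\<eta> / 2 * A + 1 / (2 * \<eta>) * (\<eta> * \<eta> / (q - 1)) = C * a powr - s"
      using \<eta> q by (simp add: C_def \<eta>_def[symmetric] field_simps)
    finally show ?thesis .
  qed
  have small: "((\<lambda>a. C * a powr - s) \<longlongrightarrow> 0) at_top"
    using tendsto_mult_right_zero[OF tendsto_neg_powr[OF _ filterlim_ident], of "- s" C] s by simp
  have "Cauchy (\<lambda>n. f (real n))"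
  proof (rule CauchyI')
    fix \<epsilon> :: real assume "0 < \<epsilon>"
    then obtain N where N: "\<And>a. N \<le> a \<Longrightarrow> C * a powr - s < \<epsilon>"
      using order_tendstoD(2)[OF small] by (auto simp: eventually_at_top_linorder)
    have "dist (f (real m)) (f (real n)) < \<epsilon>" if "nat \<lceil>max N 1\<rceil> \<le> m" "m < n" for m n
    proof -
      have m: "N \<le> real m" "1 \<le> real m" using that by linarith+
      then show ?thesis
        using diff[of "real m" "real n"] N[of "real m"] that by (simp add: dist_real_def abs_minus_commute)
    qed
    then show "\<exists>M. \<forall>m\<ge>M. \<forall>n>m. dist (f (real m)) (f (real n)) < \<epsilon>" by blast
  qed
  then obtain c where c: "(\<lambda>n. f (real n)) \<longlonglongrightarrow> c"
    using Cauchy_convergent_iff convergent_def by blast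
  have "\<bar>f v - c\<bar> \<le> C * v powr - s" if v: "1 \<le> v" for v
  proof (rule tendsto_upperbound)
    show "(\<lambda>n. \<bar>f v - f (real n)\<bar>) \<longlonglongrightarrow> \<bar>f v - c\<bar>" by (intro tendsto_intros c)
    have "\<bar>f v - f (real n)\<bar> \<le> C * v powr - s" if "nat \<lceil>v\<rceil> \<le> n" for n
      using diff[OF v, of "real n"] that by (simp add: abs_minus_commute nat_ceiling_le_eq)
    then show "\<forall>\<^sub>F n in sequentially. \<bar>f v - f (real n)\<bar> \<le> C * v powr - s"
      using eventually_sequentially by blast
  qed simp
  then show thesis using that unfolding C_def s_def by blast
qed

lemma nn_integral_powr_tail:
  fixes \<epsilon> :: real
  assumes "0 < \<epsilon>"
  shows "(\<integral>\<^sup>+v\<in>{1..}. ennreal (v powr (- 1 - \<epsilon>)) \<partial>lborel) = ennreal (1 / \<epsilon>)"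
proof -
  have "(\<integral>\<^sup>+v\<in>{1..}. ennreal (v powr (- 1 - \<epsilon>)) \<partial>lborel) = ennreal (0 - (- (1 powr - \<epsilon>) / \<epsilon>))"
  proof (rule nn_integral_FTC_atLeast[where F = "\<lambda>v. - (v powr - \<epsilon>) / \<epsilon>"])
    show "((\<lambda>v. - (v powr - \<epsilon>) / \<epsilon>) has_real_derivative x powr (- 1 - \<epsilon>)) (at x)" if "1 \<le> x" for x
    proof -
      have "((\<lambda>v. - (v powr - \<epsilon>) / \<epsilon>) has_real_derivative x powr (- \<epsilon> - 1)) (at x)"
        using that assms by (auto intro!: derivative_eq_intros)
      moreover have "- \<epsilon> - 1 = - 1 - \<epsilon>" by simp
      ultimately show ?thesis by (simp only:)
    qed
    have "((\<lambda>v. v powr - \<epsilon>) \<longlongrightarrow> 0) at_top"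
      using assms by (intro tendsto_neg_powr filterlim_ident) auto
    from tendsto_divide[OF tendsto_minus[OF this] tendsto_const, of \<epsilon>]
    show "((\<lambda>v. - (v powr - \<epsilon>) / \<epsilon>) \<longlongrightarrow> 0) at_top"
      using assms by simp
  qed auto
  then show ?thesis by simp
qed

section \<open>Geometry of the exterior\<close>

locale reissner_nordstrom =
  fixes M e :: real
  assumes charge_nonzero: "0 < \<bar>e\<bar>" and subextremal: "\<bar>e\<bar> < M"
begin

abbreviation rp :: real where "rp \<equiv> r_plus M e"
abbreviation rm :: real where "rm \<equiv> r_minus M e"
abbreviation rs :: "real \<Rightarrow> real" where "rs \<equiv> r_star M e"
abbreviation rx :: "real \<Rightarrow> real \<Rightarrow> real" where "rx \<equiv> r_ext M e"

definition F :: "real \<Rightarrow> real" where "F r = 1 - 2 * M / r + e\<^sup>2 / r\<^sup>2"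

definition dF :: "real \<Rightarrow> real" where "dF r = 2 * M / r\<^sup>2 - 2 * e\<^sup>2 / r ^ 3"

lemma M_pos: "0 < M"
  using subextremal by linarith

lemma surd_pos: "0 < sqrt (M\<^sup>2 - e\<^sup>2)"
proof -
  have "\<bar>e\<bar>\<^sup>2 < M\<^sup>2" using subextremal by (intro power_strict_mono) auto
  then show ?thesis by simp
qed

lemma surd_square: "(sqrt (M\<^sup>2 - e\<^sup>2))\<^sup>2 = M\<^sup>2 - e\<^sup>2"
  using surd_pos by (simp add: real_sqrt_gt_0_iff)

lemma rm_pos: "0 < rm"
proof -
  have "(sqrt (M\<^sup>2 - e\<^sup>2))\<^sup>2 < M\<^sup>2"
    using charge_nonzero unfolding surd_square by simp
  then show ?thesis
    using M_pos power2_less_imp_less[of "sqrt (M\<^sup>2 - e\<^sup>2)" M] by (simp add: r_minus_def)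
qed

lemma rm_less_rp: "rm < rp"
  using surd_pos by (simp add: r_minus_def r_plus_def)

lemma rp_pos: "0 < rp"
  using rm_pos rm_less_rp by linarith

lemma rp_plus_rm: "rp + rm = 2 * M"
  by (simp add: r_minus_def r_plus_def)

lemma rp_times_rm: "rp * rm = e\<^sup>2"
  using surd_square by (simp add: r_minus_def r_plus_def algebra_simps power2_eq_square)

lemma F_factor: "r \<noteq> 0 \<Longrightarrow> F r = (r - rp) * (r - rm) / r\<^sup>2"
proof -
  assume "r \<noteq> 0"
  moreover have "(r - rp) * (r - rm) = r\<^sup>2 - (rp + rm) * r + rp * rm"
    by (simp add: algebra_simps power2_eq_square)
  ultimately show ?thesis
    unfolding F_def rp_plus_rm rp_times_rm by (simp add: field_simps power2_eq_square)
qed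

lemma F_pos: "rp < r \<Longrightarrow> 0 < F r"
  using rm_less_rp rp_pos by (simp add: F_factor)

lemma F_rp: "F rp = 0"
  using rp_pos by (simp add: F_factor)

text \<open>This is the positivity of F' up to the horizon, since F' = 2 (M r - e^2) / r^3.
  Subextremality makes rm < M strict; at |e| = M the two sides would agree at the horizon and the
  red-shift would be lost.\<close>

lemma e2_less: "rp \<le> r \<Longrightarrow> e\<^sup>2 < M * r"
proof -
  assume r: "rp \<le> r"
  have "rm < M" using surd_pos by (simp add: r_minus_def)
  then have "rp * rm < rp * M" using rp_pos by simp
  also have "\<dots> \<le> r * M" using r M_pos by simp
  finally show ?thesis unfolding rp_times_rm by (simp add: mult.commute)
qed

lemma F_le_1: "rp \<le> r \<Longrightarrow> F r \<le> 1"
proof -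
  assume r: "rp \<le> r"
  then have r0: "0 < r" using rp_pos by linarith
  have "e\<^sup>2 \<le> 2 * M * r" using e2_less[OF r] mult_pos_pos[OF M_pos r0] by linarith
  then have "e\<^sup>2 / r\<^sup>2 \<le> 2 * M / r" using r0 by (simp add: field_simps power2_eq_square)
  then show ?thesis by (simp add: F_def)
qed

lemma dF_eq: "r \<noteq> 0 \<Longrightarrow> dF r = 2 * (M * r - e\<^sup>2) / r ^ 3"
  by (simp add: dF_def field_simps power2_eq_square power3_eq_cube)

lemma dF_pos: "rp \<le> r \<Longrightarrow> 0 < dF r"
  using e2_less[of r] rp_pos by (simp add: dF_eq)

lemma F_has_derivative:
  assumes "0 < r" shows "(F has_real_derivative dF r) (at r within S)"
proof -
  have "((\<lambda>r. 1 - 2 * M / r + e\<^sup>2 / r\<^sup>2) has_real_derivative dF r) (at r within S)"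
    unfolding dF_def using assms
    by (auto intro!: derivative_eq_intros simp: field_simps power2_eq_square power3_eq_cube)
  then show ?thesis
    by (simp add: F_def[abs_def])
qed

lemma F_continuous [continuous_intros]:
  "continuous_on S f \<Longrightarrow> (\<And>x. x \<in> S \<Longrightarrow> 0 < f x) \<Longrightarrow> continuous_on S (\<lambda>x. F (f x))"
  unfolding F_def by (intro continuous_intros) force+

section \<open>The tortoise coordinate and its inverse\<close>

lemma rs_has_derivative:
  assumes "rp < r" shows "(rs has_real_derivative 1 / F r) (at r within S)"
proof -
  define s where "s = sqrt (M\<^sup>2 - e\<^sup>2)"
  define a where "a = M + (2 * M\<^sup>2 - e\<^sup>2) / (2 * s)"
  define b where "b = M - (2 * M\<^sup>2 - e\<^sup>2) / (2 * s)"
  have s: "0 < s" "s\<^sup>2 = M\<^sup>2 - e\<^sup>2" using surd_pos surd_square by (auto simp: s_def)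
  have ps: "rp = M + s" "rm = M - s" by (auto simp: r_plus_def r_minus_def s_def)
  \<comment> \<open>Because 2 s = rp - rm, these are the partial fraction coefficients of r^2 / ((r
    - rp) (r - rm)) = 1 / F.\<close>
  have a: "a = rp\<^sup>2 / (2 * s)" and b: "b = - rm\<^sup>2 / (2 * s)"
    using s unfolding a_def b_def ps by (simp_all add: field_simps power2_eq_square)
  have r: "r - rp > 0" "r - rm > 0" "r > 0" using assms rm_less_rp rp_pos by linarith+
  have "((\<lambda>r. r + a * ln (r - rp) + b * ln (r - rm)) has_real_derivative
      1 + a / (r - rp) + b / (r - rm)) (at r)"
    using r by (auto intro!: derivative_eq_intros)
  then have "(rs has_real_derivative 1 + a / (r - rp) + b / (r - rm)) (at r)"
  proof (rule DERIV_cong_ev[THEN iffD1, rotated -1])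
    show "\<forall>\<^sub>F x in nhds r. x + a * ln (x - rp) + b * ln (x - rm) = rs x"
    proof -
      have "\<forall>\<^sub>F x in nhds r. x \<in> {rp<..}"
        using assms by (intro eventually_nhds_in_open) auto
      then show ?thesis
        by eventually_elim (use rm_less_rp in \<open>simp add: r_star_def a_def b_def s_def\<close>)
    qed
  qed auto
  moreover have "1 + a / (r - rp) + b / (r - rm) = 1 / F r"
  proof -
    have "1 + a / (r - rp) + b / (r - rm) =
        ((r - rp) * (r - rm) + a * (r - rm) + b * (r - rp)) / ((r - rp) * (r - rm))"
      using r by (simp add: field_simps)
    also have "(r - rp) * (r - rm) + a * (r - rm) + b * (r - rp) = r\<^sup>2"
      using s(1) unfolding a b ps by (simp add: field_simps power2_eq_square)
    also have "r\<^sup>2 / ((r - rp) * (r - rm)) = 1 / F r"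
      using r by (simp add: F_factor)
    finally show ?thesis .
  qed
  ultimately show ?thesis
    by (simp add: has_field_derivative_at_within)
qed

text \<open>As 0 < F <= 1, the slope 1/F is at least 1. This one inequality supplies injectivity of
  \<open>rs\<close>, its unboundedness at large r and the Lipschitz continuity of its
  inverse.\<close>

lemma rs_grows:
  assumes "rp < a" "a \<le> b" shows "rs a + (b - a) \<le> rs b"
proof (cases "a = b")
  case False
  then have ab: "a < b" using assms by simp
  obtain z where z: "a < z" "z < b" "rs b - rs a = (b - a) * (1 / F z)"
    using MVT2[OF ab, of rs "\<lambda>r. 1 / F r"] rs_has_derivative assms by auto
  have "1 \<le> 1 / F z" using F_pos[of z] F_le_1[of z] z assms by simp
  then have "(b - a) * 1 \<le> (b - a) * (1 / F z)" using ab by (intro mult_left_mono) auto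
  then show ?thesis using z(3) unfolding mult_1_right by linarith
qed auto

lemma rs_less_iff: "rp < a \<Longrightarrow> rp < b \<Longrightarrow> rs a < rs b \<longleftrightarrow> a < b"
  using rs_grows[of a b] rs_grows[of b a] by (cases "a < b") auto

lemma rs_le_iff: "rp < a \<Longrightarrow> rp < b \<Longrightarrow> rs a \<le> rs b \<longleftrightarrow> a \<le> b"
  using rs_less_iff[of b a] by (auto simp: not_less[symmetric])

lemma rs_inj: "inj_on rs {rp<..}"
  by (rule inj_onI) (metis greaterThan_iff order_less_irrefl linorder_neqE rs_less_iff)

text \<open>The logarithm singular at rp has a positive coefficient, by e^2 < 2 M^2, and the other
  terms stay bounded. With \<open>rs_grows\<close> it follows that \<open>rs\<close> is onto, so
  \<open>r_ext\<close> is a genuine inverse for all u and v.\<close>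

lemma rs_at_horizon: "filterlim rs at_bot (at_right rp)"
proof -
  define a where "a = M + (2 * M\<^sup>2 - e\<^sup>2) / (2 * sqrt (M\<^sup>2 - e\<^sup>2))"
  define b where "b = M - (2 * M\<^sup>2 - e\<^sup>2) / (2 * sqrt (M\<^sup>2 - e\<^sup>2))"
  have "0 < 2 * M\<^sup>2 - e\<^sup>2"
    using surd_pos zero_le_power2[of M] unfolding real_sqrt_gt_0_iff by linarith
  then have a: "0 < a" using M_pos surd_pos unfolding a_def by (intro add_pos_pos divide_pos_pos) auto
  have "filterlim (\<lambda>r. ln (r - rp)) at_bot (at_right rp)"
  proof -
    have "filterlim (\<lambda>r. r - rp) (at_right 0) (at_right rp)"
      by (rule filterlim_at_withinI) (auto intro!: tendsto_eq_intros simp: eventually_at_filter)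
    from filterlim_compose[OF ln_at_0 this] show ?thesis .
  qed
  then have 1: "filterlim (\<lambda>r. a * ln (r - rp)) at_bot (at_right rp)"
    using filterlim_tendsto_pos_mult_at_bot[OF tendsto_const a] by blast
  have 2: "((\<lambda>r. r + b * ln (r - rm)) \<longlongrightarrow> rp + b * ln (rp - rm)) (at_right rp)"
    using rm_less_rp by (auto intro!: tendsto_eq_intros)
  have "filterlim (\<lambda>r. (r + b * ln (r - rm)) + a * ln (r - rp)) at_bot (at_right rp)"
    by (rule filterlim_tendsto_add_at_bot_iff[OF 2, THEN iffD2, OF 1])
  then show ?thesis
  proof (rule filterlim_cong[THEN iffD1, rotated -1])
    show "\<forall>\<^sub>F r in at_right rp. (r + b * ln (r - rm)) + a * ln (r - rp) = rs r"
      using rm_less_rp by (auto simp: eventually_at_filter r_star_def a_def b_def)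
  qed auto
qed

lemma rs_continuous: "S \<subseteq> {rp<..} \<Longrightarrow> continuous_on S rs"
  by (rule DERIV_continuous_on[OF rs_has_derivative]) auto

lemma rs_surj: "rs ` {rp<..} = UNIV"
proof -
  have "y \<in> rs ` {rp<..}" for y
  proof -
    have "\<forall>\<^sub>F r in at_right rp. rs r \<le> y \<and> r > rp"
      using rs_at_horizon unfolding filterlim_at_bot
      by (auto intro!: eventually_conj simp: eventually_at_right_less)
    then obtain a where a: "rs a \<le> y" "rp < a"
      using eventually_happens[of _ "at_right rp"] by auto
    define b where "b = a + \<bar>y - rs a\<bar>"
    have "y \<le> rs b" using rs_grows[of a b] a by (auto simp: b_def)
    moreover have "continuous_on {a..b} rs" using a by (intro rs_continuous) auto
    ultimately obtain r where "a \<le> r" "r \<le> b" "rs r = y"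
      using IVT'[of rs a y b] a by (auto simp: b_def)
    then show ?thesis using a by auto
  qed
  then show ?thesis by auto
qed

lemma rx_gt: "rp < rx u v"
  using the_inv_into_into[OF rs_inj, of "v - u" "{rp<..}"] rs_surj
  by (auto simp: r_ext_def)

lemma rx_pos: "0 < rx u v"
  using rx_gt[of u v] rp_pos by linarith

lemma rs_rx: "rs (rx u v) = v - u"
  using f_the_inv_into_f[OF rs_inj, of "v - u"] rs_surj by (auto simp: r_ext_def)

lemma rx_rs: "rp < r \<Longrightarrow> v - u = rs r \<Longrightarrow> rx u v = r"
  by (simp add: r_ext_def the_inv_into_f_f[OF rs_inj])

lemma rx_le_iff: "rp < r \<Longrightarrow> rx u v \<le> r \<longleftrightarrow> v - u \<le> rs r"
  by (metis rs_le_iff rs_rx rx_gt)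

text \<open>Only v - u matters, so both partial derivatives of \<open>rx\<close> come from the
  one-variable inverse of \<open>rs\<close>, whose derivative is F.\<close>

lemma rx_shift: "rx u v = rx (- (v - u)) 0"
  by (rule rx_rs) (simp_all add: rx_gt rs_rx)

lemma rx_0_has_derivative: "((\<lambda>s. rx (- s) 0) has_real_derivative F (rx (- s) 0)) (at s within S)"
proof -
  have "((\<lambda>s. rx (- s) 0) has_real_derivative inverse (1 / F (rx (- s) 0))) (at s)"
  proof (rule DERIV_inverse_function[where f = rs])
    show "(rs has_real_derivative 1 / F (rx (- s) 0)) (at (rx (- s) 0))"
      by (rule rs_has_derivative) (rule rx_gt)
    show "1 / F (rx (- s) 0) \<noteq> 0" using F_pos[OF rx_gt[of "- s" 0]] by simp
    show "s - 1 < s" "s < s + 1" by auto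
    show "rs (rx (- y) 0) = y" for y by (simp add: rs_rx)
    have "\<bar>rx (- s) 0 - rx (- t) 0\<bar> \<le> \<bar>s - t\<bar>" for s t
      using rs_grows[OF rx_gt, of "- s" 0 "rx (- t) 0"] rs_grows[OF rx_gt, of "- t" 0 "rx (- s) 0"]
      by (cases "rx (- s) 0 \<le> rx (- t) 0") (auto simp: rs_rx)
    then show "isCont (\<lambda>s. rx (- s) 0) s"
      unfolding continuous_at_eps_delta by (metis dist_real_def le_less_trans)
  qed
  then show ?thesis by (simp add: has_field_derivative_at_within)
qed

lemma rx_has_derivative_v: "((\<lambda>v. rx u v) has_real_derivative F (rx u v)) (at v within S)"
proof -
  have "((\<lambda>v. rx (- (v - u)) 0) has_real_derivative F (rx (- (v - u)) 0) * 1) (at v within S)"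
    by (rule DERIV_chain2[OF rx_0_has_derivative]) (auto intro!: derivative_eq_intros)
  then show ?thesis by (simp only: rx_shift[of u, symmetric] mult_1_right)
qed

lemma rx_has_derivative_u: "((\<lambda>u. rx u v) has_real_derivative - F (rx u v)) (at u within S)"
proof -
  have "((\<lambda>u. rx (- (v - u)) 0) has_real_derivative F (rx (- (v - u)) 0) * - 1) (at u within S)"
    by (rule DERIV_chain2[OF rx_0_has_derivative]) (auto intro!: derivative_eq_intros)
  then show ?thesis by (simp only: rx_shift[of _ v, symmetric] mult_minus1_right)
qed

lemma rx_mono_v: "v \<le> v' \<Longrightarrow> rx u v \<le> rx u v'"
  by (simp add: rx_le_iff rx_gt rs_rx)

lemma rx_antimono_u: "u \<le> u' \<Longrightarrow> rx u' v \<le> rx u v"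
  by (simp add: rx_le_iff rx_gt rs_rx)

lemma rx_tendsto_horizon: "((\<lambda>u. rx u v) \<longlongrightarrow> rp) at_top"
proof (rule order_tendstoI)
  fix a assume "a < rp"
  then show "\<forall>\<^sub>F u in at_top. a < rx u v" using rx_gt[of _ v] by (auto intro: always_eventually less_trans)
next
  fix a assume a: "rp < a"
  have "rx u v < a" if "u > v - rs a" for u
    using a that rs_less_iff[OF rx_gt[of u v] a] by (simp add: rs_rx)
  then show "\<forall>\<^sub>F u in at_top. rx u v < a"
    by (meson eventually_at_top_dense)
qed

lemma rx_at_top: "filterlim (\<lambda>v. rx u v) at_top at_top"
  unfolding filterlim_at_top_gt[where c = rp]
proof safe
  fix Z assume Z: "rp < Z"
  have "Z \<le> rx u v" if "v \<ge> u + rs Z" for v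
    using that rs_le_iff[OF Z rx_gt[of u v]] by (simp add: rs_rx)
  then show "\<forall>\<^sub>F v in at_top. Z \<le> rx u v"
    by (meson eventually_at_top_linorder)
qed

lemma rx_continuous: "continuous_on S (\<lambda>(u, v). rx u v)"
proof -
  have "continuous_on UNIV (\<lambda>s. rx (- s) 0)"
    by (rule DERIV_continuous_on[OF rx_0_has_derivative])
  then have "continuous_on S (\<lambda>p. rx (- (snd p - fst p)) 0)"
    by (rule continuous_on_compose2) (auto intro!: continuous_intros)
  then show ?thesis by (simp only: case_prod_unfold rx_shift[of "fst _" "snd _", symmetric])
qed

lemma rx_continuous' [continuous_intros]:
  "continuous_on S f \<Longrightarrow> continuous_on S g \<Longrightarrow> continuous_on S (\<lambda>x. rx (f x) (g x))"
  using continuous_on_compose2[OF rx_continuous[of UNIV], of S "\<lambda>x. (f x, g x)"]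
  by (auto intro!: continuous_intros)

text \<open>F' tends to 0 at large r, so K must depend on R. Here p / K bounds the logarithmic
  derivative of the weight (v + K)^p; the factor 2 reserves half of the damping for the forcing
  term.\<close>

lemma red_shift_lower_bound:
  assumes "0 < p" "rp \<le> R"
  obtains K where "0 < K" "\<And>r. rp \<le> r \<Longrightarrow> r \<le> R \<Longrightarrow> 2 * (p / K) \<le> dF r"
proof
  \<comment> \<open>The least value of M r - e^2 on r >= rp; together with r^3 <= R^3 it bounds F'
    from below.\<close>
  define m where "m = M * rp - e\<^sup>2"
  have m: "0 < m" using e2_less[of rp] by (simp add: m_def)
  have R: "0 < R" using assms rp_pos by linarith
  show "0 < p * R ^ 3 / m" using m R assms by simp
  fix r assume r: "rp \<le> r" "r \<le> R"
  then have r0: "0 < r" using rp_pos by linarith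
  have "2 * (p / (p * R ^ 3 / m)) = 2 * m / R ^ 3" using assms m by simp
  also have "\<dots> \<le> 2 * (M * r - e\<^sup>2) / r ^ 3"
    using r r0 M_pos e2_less[OF r(1)] by (intro frac_le mult_left_mono power_mono) (auto simp: m_def)
  also have "\<dots> = dF r" using r0 by (simp add: dF_eq)
  finally show "2 * (p / (p * R ^ 3 / m)) \<le> dF r" .
qed

text \<open>The right-hand side of \<open>weighted_bound\<close> for C0 = rp C (1 + K)^p and D1 = D,
  divided by rp.\<close>

definition decay_const :: "real \<Rightarrow> real \<Rightarrow> real \<Rightarrow> real \<Rightarrow> real \<Rightarrow> real" where
  "decay_const p K R C D =
    (rp * C * (1 + K) powr p + max ((1 + K) powr p * D) (4 * C * (1 + K) powr p)
      * exp (4 / rp * (R - rp)) * (rp / 4)) / rp"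

end

section \<open>The wave equation in null coordinates\<close>

locale exterior_solution = reissner_nordstrom +
  fixes U0 :: real and \<phi> :: "real \<times> real \<Rightarrow> real" and \<phi>' :: "real \<times> real \<Rightarrow> ((real \<times> real) \<Rightarrow>\<^sub>L real)"
  assumes deriv: "p \<in> region M e U0 \<Longrightarrow> (\<phi> has_derivative blinfun_apply (\<phi>' p)) (at p within region M e U0)"
    and deriv_continuous: "continuous_on (region M e U0) \<phi>'"
    and wave: "wave_eq_on {- U0..} (r_ext M e) (ext_null M e \<phi>)"
begin

text \<open>The closed exterior. The horizon is a separate case because \<open>rs\<close> has no
  meaningful value at rp.\<close>

definition ext :: "(real \<times> real) set" where
  "ext = {(v, r). v \<ge> 1 \<and> rp \<le> r \<and> (r = rp \<or> v - rs r \<ge> - U0)}"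

lemma ext_subset_region: "ext \<subseteq> region M e U0"
  by (auto simp: ext_def region_def)

lemma ext_iff: "(v, r) \<in> ext \<longleftrightarrow> (v, r) \<in> region M e U0 \<and> rp \<le> r"
  by (auto simp: ext_def region_def)

lemma rx_in_ext: "- U0 \<le> u \<Longrightarrow> 1 \<le> v \<Longrightarrow> (v, rx u v) \<in> ext"
  using rx_gt[of u v] by (simp add: ext_def rs_rx)

lemma horizon_in_ext: "1 \<le> v \<Longrightarrow> (v, rp) \<in> ext"
  by (simp add: ext_def)

lemma ext_slice: "(v, r) \<in> ext \<Longrightarrow> rp \<le> r' \<Longrightarrow> r' \<le> r \<Longrightarrow> (v, r') \<in> ext"
  using rs_le_iff[of r' r] by (cases "r' = rp") (auto simp: ext_def)

lemma ext_exteriorE: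
  assumes "(v, r) \<in> ext" "rp < r"
  obtains u where "1 \<le> v" "- U0 \<le> u" "r = rx u v"
proof
  show "1 \<le> v" "- U0 \<le> v - rs r" using assms by (auto simp: ext_def)
  show "r = rx (v - rs r) v" using assms by (simp add: rx_rs)
qed

definition X :: "real \<Rightarrow> real \<Rightarrow> real" where "X v r = \<phi>' (v, r) (0, 1)"

text \<open>(1, F r) is the velocity of v -> (v, r) at fixed u. At r = rp it becomes (1, 0), the
  direction of the horizon itself, so one formula covers both cases.\<close>

definition Y :: "real \<Rightarrow> real \<Rightarrow> real" where "Y v r = \<phi>' (v, r) (1, F r)"

lemma X_continuous: "continuous_on ext (\<lambda>(v, r). X v r)"
  unfolding X_def case_prod_unfold
  by (auto intro!: blinfun.continuous_on continuous_intros continuous_on_subset[OF deriv_continuous ext_subset_region])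

lemma Y_continuous: "continuous_on ext (\<lambda>(v, r). Y v r)"
  unfolding Y_def case_prod_unfold using rp_pos
  by (auto intro!: blinfun.continuous_on continuous_intros continuous_on_subset[OF deriv_continuous ext_subset_region])
    (auto simp: ext_def)

lemma \<phi>_continuous: "continuous_on ext \<phi>"
  by (rule continuous_on_subset[OF _ ext_subset_region]) (meson deriv has_derivative_continuous_on)

lemma compose_continuous:
  assumes "continuous_on ext (\<lambda>(v, r). f v r)" "continuous_on S g" "continuous_on S h"
    "\<And>x. x \<in> S \<Longrightarrow> (g x, h x) \<in> ext"
  shows "continuous_on S (\<lambda>x. f (g x) (h x))"
  using continuous_on_compose2[OF assms(1), of S "\<lambda>x. (g x, h x)"] assms(2-4)
  by (auto intro!: continuous_intros)

lemmas X_compose_continuous [continuous_intros] = compose_continuous[OF X_continuous]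
lemmas Y_compose_continuous [continuous_intros] = compose_continuous[OF Y_continuous]
lemmas \<phi>_compose_continuous [continuous_intros] =
  compose_continuous[where f = "\<lambda>v r. \<phi> (v, r)", simplified, OF \<phi>_continuous]

text \<open>All derivatives of phi used below are this chain rule along a curve in
  \<open>ext\<close>. Differentiability within the image of the curve is enough, so boundary points
  and the horizon are treated like the others.\<close>

lemma \<phi>_has_derivative_along:
  assumes "(c has_vector_derivative d) (at t within S)" "c ` S \<subseteq> ext" "t \<in> S"
  shows "((\<lambda>t. \<phi> (c t)) has_real_derivative \<phi>' (c t) d) (at t within S)"
proof -
  have "c t \<in> region M e U0" "c ` S \<subseteq> region M e U0"
    using assms ext_subset_region by auto
  then have "(\<phi> has_derivative \<phi>' (c t)) (at (c t) within c ` S)"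
    using deriv has_derivative_subset by blast
  from has_derivative_in_compose[OF assms(1)[unfolded has_vector_derivative_def] this]
  have "((\<lambda>t. \<phi> (c t)) has_derivative (\<lambda>h. \<phi>' (c t) (h *\<^sub>R d))) (at t within S)" .
  then show ?thesis
    by (simp add: has_field_derivative_def blinfun.scaleR_right mult_commute_abs)
qed

lemma \<phi>_has_derivative_v:
  assumes "- U0 \<le> u" "1 \<le> v"
  shows "((\<lambda>v. \<phi> (v, rx u v)) has_real_derivative Y v (rx u v)) (at v within {1..})"
  unfolding Y_def using assms rx_in_ext rx_has_derivative_v[of u v "{1..}"]
  by (intro \<phi>_has_derivative_along)
    (auto intro!: has_vector_derivative_Pair simp: has_real_derivative_iff_has_vector_derivative)

lemma \<phi>_has_derivative_u:
  assumes "- U0 \<le> u" "1 \<le> v"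
  shows "((\<lambda>u. \<phi> (v, rx u v)) has_real_derivative - F (rx u v) * X v (rx u v)) (at u within {- U0..})"
proof -
  have "((\<lambda>u. \<phi> (v, rx u v)) has_real_derivative \<phi>' (v, rx u v) (0, - F (rx u v))) (at u within {- U0..})"
    using assms rx_in_ext rx_has_derivative_u[of v u "{- U0..}"]
    by (intro \<phi>_has_derivative_along)
      (auto intro!: has_vector_derivative_Pair simp: has_real_derivative_iff_has_vector_derivative)
  moreover have "\<phi>' (v, r) (0, c) = c * X v r" for c r
    using blinfun.scaleR_right[of "\<phi>' (v, r)" c "(0, 1)"] by (simp add: X_def)
  ultimately show ?thesis by simp
qed

lemma \<phi>_has_derivative_r:
  assumes "(v, r0) \<in> ext" "r \<in> {rp..r0}"
  shows "((\<lambda>r. \<phi> (v, r)) has_real_derivative X v r) (at r within {rp..r0})"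
  unfolding X_def using assms ext_slice
  by (intro \<phi>_has_derivative_along)
    (auto intro!: has_vector_derivative_Pair simp: has_vector_derivative_def intro!: derivative_eq_intros)

lemma \<phi>_has_derivative_horizon:
  assumes "1 \<le> v"
  shows "((\<lambda>v. \<phi> (v, rp)) has_real_derivative Y v rp) (at v within {1..})"
  unfolding Y_def F_rp using assms horizon_in_ext
  by (intro \<phi>_has_derivative_along)
    (auto intro!: has_vector_derivative_Pair simp: has_vector_derivative_def intro!: derivative_eq_intros)

lemma d_v_rx: "1 \<le> v \<Longrightarrow> d_v rx u v = F (rx u v)"
  unfolding d_v_def by (intro vector_derivative_within_atLeast rx_has_derivative_v)

lemma d_u_rx: "- U0 \<le> u \<Longrightarrow> d_u {- U0..} rx u v = - F (rx u v)"
  unfolding d_u_def by (intro vector_derivative_within_atLeast rx_has_derivative_u)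

lemma d_v_\<phi>: "- U0 \<le> u \<Longrightarrow> 1 \<le> v \<Longrightarrow> d_v (ext_null M e \<phi>) u v = Y v (rx u v)"
  unfolding d_v_def ext_null_def by (intro vector_derivative_within_atLeast \<phi>_has_derivative_v)

lemma d_u_\<phi>: "- U0 \<le> u \<Longrightarrow> 1 \<le> v \<Longrightarrow> d_u {- U0..} (ext_null M e \<phi>) u v = - F (rx u v) * X v (rx u v)"
  unfolding d_u_def ext_null_def by (intro vector_derivative_within_atLeast \<phi>_has_derivative_u)

text \<open>d_v(r phi) at fixed u, expanded by the product rule so that it has a value on the
  horizon too.\<close>

definition Z :: "real \<Rightarrow> real \<Rightarrow> real" where "Z v r = F r * \<phi> (v, r) + r * Y v r"

lemma d_v_times_r_\<phi>:
  assumes "- U0 \<le> u" "1 \<le> v"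
  shows "d_v (ext_null M e (times_r \<phi>)) u v = Z v (rx u v)"
proof -
  have "((\<lambda>v. rx u v * \<phi> (v, rx u v)) has_real_derivative Z v (rx u v)) (at v within {1..})"
    unfolding Z_def
    by (rule derivative_eq_intros rx_has_derivative_v \<phi>_has_derivative_v assms refl)+ (simp add: mult.commute)
  then show ?thesis
    unfolding d_v_def ext_null_def times_r_def using assms
    by (simp add: vector_derivative_within_atLeast)
qed

lemma d_u_times_r_\<phi>:
  assumes "- U0 \<le> u" "1 \<le> v"
  shows "d_u {- U0..} (ext_null M e (times_r \<phi>)) u v
    = - F (rx u v) * (\<phi> (v, rx u v) + rx u v * X v (rx u v))"
proof -
  have "((\<lambda>u. rx u v * \<phi> (v, rx u v)) has_real_derivative
      - F (rx u v) * (\<phi> (v, rx u v) + rx u v * X v (rx u v))) (at u within {- U0..})"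
    by (rule derivative_eq_intros rx_has_derivative_u \<phi>_has_derivative_u assms refl)+
      (simp add: algebra_simps)
  then show ?thesis
    unfolding d_u_def ext_null_def times_r_def using assms
    by (simp add: vector_derivative_within_atLeast)
qed

text \<open>The value of d_u d_v phi that the equation prescribes once d_v r = F, d_u r = -F and d_u
  phi = -F X are inserted.\<close>

definition G :: "real \<Rightarrow> real \<Rightarrow> real" where "G v r = F r * (F r * X v r + Y v r) / r"

lemma Y_has_derivative_u:
  assumes "- U0 \<le> u" "1 \<le> v"
  shows "((\<lambda>u. Y v (rx u v)) has_real_derivative G v (rx u v)) (at u within {- U0..})"
proof -
  let ?\<psi> = "ext_null M e \<phi>"
  have "(\<lambda>u. d_v ?\<psi> u v) differentiable (at u within {- U0..})"
    and eq: "d_u {- U0..} (d_v ?\<psi>) u v = - (d_v rx u v * d_u {- U0..} ?\<psi> u v / rx u v)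
        - d_u {- U0..} rx u v * d_v ?\<psi> u v / rx u v"
    using wave assms unfolding wave_eq_on_def by auto
  then have "((\<lambda>u. d_v ?\<psi> u v) has_vector_derivative d_u {- U0..} (d_v ?\<psi>) u v) (at u within {- U0..})"
    unfolding d_u_def by (simp add: vector_derivative_works)
  moreover have "d_u {- U0..} (d_v ?\<psi>) u v = G v (rx u v)"
    unfolding eq d_v_rx[OF assms(2)] d_u_rx[OF assms(1)] d_v_\<phi>[OF assms] d_u_\<phi>[OF assms] G_def
    by (simp add: algebra_simps add_divide_distrib)
  ultimately have "((\<lambda>u. d_v ?\<psi> u v) has_real_derivative G v (rx u v)) (at u within {- U0..})"
    by (simp add: has_real_derivative_iff_has_vector_derivative)
  then show ?thesis
    by (rule has_field_derivative_transform_within[where d = 1]) (use assms in \<open>auto simp: d_v_\<phi>\<close>)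
qed

lemma u_derivative_has_derivative_v:
  assumes "- U0 \<le> u" "1 \<le> v"
  shows "((\<lambda>v. - F (rx u v) * X v (rx u v)) has_real_derivative G v (rx u v)) (at v within {1..})"
proof (rule mixed_partials_commute[OF \<phi>_has_derivative_v \<phi>_has_derivative_u Y_has_derivative_u])
  show "continuous_on {1..} (\<lambda>v. Y v (rx u v))" if "- U0 \<le> u" for u
    using that rx_in_ext by (intro continuous_intros) auto
  show "continuous_on ({- U0..} \<times> {1..}) (\<lambda>(u, v). G v (rx u v))"
    unfolding G_def case_prod_unfold using rx_in_ext
    by (intro continuous_intros) (auto simp: rx_pos less_imp_neq[OF rx_pos, symmetric])
qed (use assms in auto)

text \<open>X is recovered from d_u phi = -F X by dividing by F; differentiating 1/F produces the
  red-shift term -F' X.\<close>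

lemma X_has_derivative_v:
  assumes "- U0 \<le> u" "1 \<le> v"
  shows "((\<lambda>v. X v (rx u v)) has_real_derivative
    - dF (rx u v) * X v (rx u v) - (F (rx u v) * X v (rx u v) + Y v (rx u v)) / rx u v) (at v within {1..})"
proof -
  have Fn: "F (rx u v) \<noteq> 0" for v using F_pos[OF rx_gt, of u v] by simp
  have dF: "((\<lambda>v. F (rx u v)) has_real_derivative dF (rx u v) * F (rx u v)) (at v within {1..})"
    by (rule DERIV_chain2[OF F_has_derivative[OF rx_pos] rx_has_derivative_v])
  have "((\<lambda>v. - (- F (rx u v) * X v (rx u v)) / F (rx u v)) has_real_derivative
    - dF (rx u v) * X v (rx u v) - (F (rx u v) * X v (rx u v) + Y v (rx u v)) / rx u v) (at v within {1..})"
    by (rule derivative_eq_intros u_derivative_has_derivative_v assms dF Fn refl)+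
      (use Fn rx_pos[of u v] in \<open>simp add: G_def field_simps\<close>)
  then show ?thesis by (simp add: Fn)
qed

section \<open>Propagation from the horizon\<close>

lemma ext_rx_iff: "(v, r) \<in> ext \<longleftrightarrow> 1 \<le> v \<and> rp \<le> r \<and> r \<le> rx (- U0) v"
proof (cases "rp < r")
  case True
  then show ?thesis
    using rs_le_iff[OF True rx_gt[of "- U0" v]] by (auto simp: ext_def rs_rx)
next
  case False
  then show ?thesis using rx_gt[of "- U0" v] by (auto simp: ext_def)
qed

text \<open>Serves to make the supremum N in \<open>weighted_bound\<close> finite, without which an
  inequality that bounds N by terms with N / 2 could not be absorbed.\<close>

lemma compact_ext_slab: "compact {(v, r) \<in> ext. v \<le> V \<and> r \<le> R}"
proof -
  have "{(v, r) \<in> ext. v \<le> V \<and> r \<le> R} = ({1..V} \<times> {rp..R}) \<inter> {p. snd p \<le> rx (- U0) (fst p)}"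
    by (auto simp: ext_rx_iff)
  moreover have "closed {p :: real \<times> real. snd p \<le> rx (- U0) (fst p)}"
    by (intro closed_Collect_le continuous_intros)
  ultimately show ?thesis by (simp add: compact_Int_closed compact_Times)
qed

definition W :: "real \<Rightarrow> real \<Rightarrow> real" where "W v r = \<phi> (v, r) + r * X v r"

lemma W_continuous: "continuous_on ext (\<lambda>(v, r). W v r)"
  unfolding W_def case_prod_unfold
  by (intro continuous_intros) auto

text \<open>The terms Y and F X contributed by phi and by the factor r cancel those in r d_v X, and
  only -F' r X = F' (phi - W) is left.\<close>

lemma W_has_derivative_v:
  assumes "- U0 \<le> u" "1 \<le> v"
  shows "((\<lambda>v. W v (rx u v)) has_real_derivative
    dF (rx u v) * (\<phi> (v, rx u v) - W v (rx u v))) (at v within {1..})"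
  unfolding W_def
  by (rule derivative_eq_intros \<phi>_has_derivative_v X_has_derivative_v rx_has_derivative_v assms refl)+
    (use rx_pos[of u v] in \<open>simp add: field_simps\<close>)

text \<open>
  In the variables \<open>\<Psi> = r (\<phi> - c)\<close> and \<open>\<partial>\<^sub>r \<Psi> = W - c\<close> the wave equation is a Goursat problem
  in which one integrates outwards in \<open>r\<close> from the horizon and forwards in \<open>v\<close> at fixed \<open>u\<close>. The
  latter transport equation is damped by \<open>F' > 0\<close> (the red-shift), which absorbs the
  growth of the weight \<open>(v + K)\<^sup>p\<close>.
\<close>

lemma weighted_bound:
  fixes c p K R C0 D1 :: real
  assumes p: "0 < p" and K: "0 < K" and damping: "\<And>r. rp \<le> r \<Longrightarrow> r \<le> R \<Longrightarrow> 2 * (p / K) \<le> dF r"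
    and horizon: "\<And>v. 1 \<le> v \<Longrightarrow> (v + K) powr p * \<bar>rp * (\<phi> (v, rp) - c)\<bar> \<le> C0"
    and init: "\<And>r. (1, r) \<in> ext \<Longrightarrow> rp < r \<Longrightarrow> r \<le> R \<Longrightarrow> \<bar>W 1 r - c\<bar> \<le> D1"
    and ext: "(v, r) \<in> ext" and r: "r \<le> R"
  shows "(v + K) powr p * \<bar>r * (\<phi> (v, r) - c)\<bar>
    \<le> C0 + max ((1 + K) powr p * D1) (4 * C0 / rp) * exp (4 / rp * (R - rp)) * (rp / 4)"
proof -
  \<comment> \<open>Chosen so that 2 / (\<open>\<kappa>\<close> rp) = 1/2, the factor with which N
    reappears in its own estimate.\<close>
  define \<kappa> where "\<kappa> = 4 / rp"
  have \<kappa>: "0 < \<kappa>" using rp_pos by (simp add: \<kappa>_def)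
  define \<Psi> where "\<Psi> v r = r * (\<phi> (v, r) - c)" for v r
  define w where "w v = (v + K) powr p" for v
  have w: "0 < w v" if "1 \<le> v" for v using that K by (simp add: w_def)
  have hor: "w v * \<bar>\<Psi> v rp\<bar> \<le> C0" if "1 \<le> v" for v
    using horizon[OF that] by (simp add: w_def \<Psi>_def)
  have C0: "0 \<le> C0" using order_trans[OF _ hor[of 1]] w[of 1] by simp
  show ?thesis
  proof (cases "rp < r")
    case False
    then have "w v * \<bar>\<Psi> v r\<bar> \<le> C0" using ext hor[of v] by (auto simp: ext_rx_iff)
    moreover have "0 \<le> max ((1 + K) powr p * D1) (4 * C0 / rp) * exp (4 / rp * (R - rp)) * (rp / 4)"
      using C0 rp_pos by (intro mult_nonneg_nonneg) (auto simp: le_max_iff_disj)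
    ultimately show ?thesis by (simp add: w_def \<Psi>_def)
  next
    case True
    define S where "S = {(v', r') \<in> ext. v' \<le> v \<and> r' \<le> R}"
    \<comment> \<open>The exponential gains a factor 1 / \<open>\<kappa>\<close> in the outward
      integration, and along fixed u, where r increases, its derivative only adds damping.\<close>
    define Wt where "Wt v r = exp (- (\<kappa> * (r - rp))) * w v * (W v r - c)" for v r
    \<comment> \<open>Horizon points are left out since they lie on no curve of fixed finite
      u.\<close>
    define T where "T = (\<lambda>(v, r). \<bar>Wt v r\<bar>) ` {(v', r') \<in> S. rp < r'}"
    define N where "N = Sup T"
    have vr: "(v, r) \<in> S" "1 \<le> v" using ext r by (auto simp: S_def ext_rx_iff)
    then have T_ne: "T \<noteq> {}" using True by (auto simp: T_def)
    have "continuous_on S (\<lambda>(v, r). \<bar>Wt v r\<bar>)"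
      unfolding Wt_def w_def case_prod_unfold
      by (intro continuous_intros compose_continuous[OF W_continuous]) (use K in \<open>auto simp: S_def ext_rx_iff\<close>)
    then have "bounded ((\<lambda>(v, r). \<bar>Wt v r\<bar>) ` S)"
      using compact_ext_slab[of v R] compact_continuous_image compact_imp_bounded unfolding S_def by blast
    then have T_bdd: "bdd_above T"
      by (rule bdd_above_mono[OF bounded_imp_bdd_above]) (auto simp: T_def)
    have N: "\<bar>Wt v' r'\<bar> \<le> N" if "(v', r') \<in> S" "rp < r'" for v' r'
      unfolding N_def using that by (intro cSup_upper T_bdd) (auto simp: T_def)
    have N0: "0 \<le> N" using order_trans[OF abs_ge_zero N[OF vr(1) True]] .
    \<comment> \<open>Integrates d_r \<open>\<Psi>\<close> = W - c outwards from the horizon, with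
      |W - c| <= N exp(\<open>\<kappa>\<close> (r - rp)) / w.\<close>
    have \<Psi>_bound: "w v' * \<bar>\<Psi> v' r'\<bar> \<le> C0 + N * exp (\<kappa> * (r' - rp)) / \<kappa>"
      if S': "(v', r') \<in> S" and r': "rp < r'" for v' r'
    proof -
      have v': "1 \<le> v'" and ext': "(v', r') \<in> ext" using S' by (auto simp: S_def ext_rx_iff)
      define E where "E r = N / (\<kappa> * w v') * exp (\<kappa> * (r - rp))" for r
      have "norm (\<Psi> v' r' - \<Psi> v' rp) \<le> E r' - E rp"
      proof (rule differentiable_bound_general[OF r'])
        have "((\<lambda>r. \<Psi> v' r) has_real_derivative W v' x - c) (at x within {rp..r'})"
          if "x \<in> {rp..r'}" for x
          unfolding \<Psi>_def W_def
          by (rule derivative_eq_intros \<phi>_has_derivative_r[OF ext'] that refl)+ simp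
        note \<Psi>_deriv = this
        show "continuous_on {rp..r'} (\<lambda>r. \<Psi> v' r)" by (rule DERIV_continuous_on[OF \<Psi>_deriv])
        show "continuous_on {rp..r'} E" unfolding E_def by (intro continuous_intros)
        fix x assume x: "rp < x" "x < r'"
        show "((\<lambda>r. \<Psi> v' r) has_vector_derivative W v' x - c) (at x)"
          using \<Psi>_deriv[of x] x at_within_interior[of x "{rp..r'}"]
          by (simp add: has_real_derivative_iff_has_vector_derivative)
        show "(E has_vector_derivative N / w v' * exp (\<kappa> * (x - rp))) (at x)"
          unfolding E_def has_real_derivative_iff_has_vector_derivative[symmetric]
          using \<kappa> less_imp_neq[OF w[OF v'], symmetric] by (auto intro!: derivative_eq_intros)
        have "(v', x) \<in> S" using S' ext_slice[OF ext', of x] x by (auto simp: S_def)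
        then have "\<bar>Wt v' x\<bar> \<le> N" using x N by blast
        moreover have "\<bar>Wt v' x\<bar> = \<bar>W v' x - c\<bar> * w v' / exp (\<kappa> * (x - rp))"
          using w[OF v'] unfolding Wt_def abs_mult exp_minus by (simp add: divide_inverse mult_ac)
        ultimately have "\<bar>W v' x - c\<bar> * w v' \<le> N * exp (\<kappa> * (x - rp))"
          by (simp only: pos_divide_le_eq[OF exp_gt_zero])
        then show "norm (W v' x - c) \<le> N / w v' * exp (\<kappa> * (x - rp))"
          unfolding times_divide_eq_left pos_le_divide_eq[OF w[OF v']] real_norm_def .
      qed
      moreover have "0 \<le> E rp" using N0 \<kappa> w[OF v'] by (simp add: E_def)
      ultimately have "\<bar>\<Psi> v' r'\<bar> \<le> \<bar>\<Psi> v' rp\<bar> + E r'" by simp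
      then have "w v' * \<bar>\<Psi> v' r'\<bar> \<le> w v' * \<bar>\<Psi> v' rp\<bar> + w v' * E r'"
        using mult_left_mono[of _ _ "w v'"] w[OF v'] by (fastforce simp: distrib_left)
      also have "w v' * E r' = N * exp (\<kappa> * (r' - rp)) / \<kappa>"
        using w[OF v'] \<kappa> by (simp add: E_def)
      finally show ?thesis using hor[OF v'] by linarith
    qed
    \<comment> \<open>Twice the bound on the forcing \<open>g\<close> below: once |y| exceeds it,
      half of the damping outweighs the forcing.\<close>
    define \<beta> where "\<beta> = 2 * (C0 + N / \<kappa>) / rp"
    define B where "B = max ((1 + K) powr p * D1) \<beta>"
    have step: "\<bar>Wt v' r'\<bar> \<le> B" if S': "(v', r') \<in> S" and r': "rp < r'" for v' r'
    proof -
      have ext': "(v', r') \<in> ext" using S' by (simp add: S_def)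
      obtain u where u: "1 \<le> v'" "- U0 \<le> u" "r' = rx u v'"
        by (rule ext_exteriorE[OF ext' r'])
      define y where "y t = Wt t (rx u t)" for t
      define g where "g t = exp (- (\<kappa> * (rx u t - rp))) * w t * (\<phi> (t, rx u t) - c)" for t
      \<comment> \<open>The coefficient of \<open>y\<close> collects the growth of the weight, the
        exponential as r moves with speed F, and the red-shift.\<close>
      define y' where "y' t = (p / (t + K) - \<kappa> * F (rx u t) - dF (rx u t)) * y t + dF (rx u t) * g t" for t
      have inS: "(t, rx u t) \<in> S" if "t \<in> {1..v'}" for t
        using that u S' rx_in_ext[of u t] rx_mono_v[of t v' u] by (auto simp: S_def)
      have y_deriv: "(y has_real_derivative y' t) (at t within {1..v'})" if t: "t \<in> {1..v'}" for t
      proof -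
        have tK: "0 < t + K" "1 \<le> t" using t K by auto
        have w': "(w has_real_derivative p / (t + K) * w t) (at t within {1..})"
          unfolding w_def using tK by (auto intro!: derivative_eq_intros simp: powr_diff)
        have "(y has_real_derivative y' t) (at t within {1..})"
          unfolding y_def Wt_def
          by (rule derivative_eq_intros w' W_has_derivative_v rx_has_derivative_v u tK refl)+
            (simp add: y'_def y_def Wt_def g_def algebra_simps diff_divide_distrib)
        then show ?thesis by (rule has_field_derivative_subset) auto
      qed
      have g_bound: "\<bar>g t\<bar> \<le> \<beta> / 2" if t: "t \<in> {1..v'}" for t
      proof -
        let ?x = "\<kappa> * (rx u t - rp)"
        have x0: "0 \<le> ?x" using \<kappa> rx_gt[of u t] by (intro mult_nonneg_nonneg) auto
        have "rp * \<bar>g t\<bar> \<le> rx u t * \<bar>g t\<bar>" using rx_gt[of u t] by (intro mult_right_mono) auto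
        also have "\<dots> = exp (- ?x) * (w t * \<bar>\<Psi> t (rx u t)\<bar>)"
          using rx_pos[of u t] w[of t] t by (simp add: g_def \<Psi>_def abs_mult)
        also have "\<dots> \<le> exp (- ?x) * (C0 + N * exp ?x / \<kappa>)"
          by (intro mult_left_mono \<Psi>_bound inS t rx_gt) simp
        also have "\<dots> = exp (- ?x) * C0 + N / \<kappa>"
          by (simp add: distrib_left exp_minus)
        also have "\<dots> \<le> C0 + N / \<kappa>" using C0 x0 by (simp add: mult_left_le_one_le)
        also have "\<dots> = rp * (\<beta> / 2)" using rp_pos by (simp add: \<beta>_def)
        finally show ?thesis using rp_pos by (simp only: mult_le_cancel_left_pos)
      qed
      have \<beta>0: "0 \<le> \<beta>" using C0 N0 \<kappa> rp_pos by (simp add: \<beta>_def)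
      \<comment> \<open>The sign \<open>s\<close> treats both barriers at once. The weight costs p /
        (t + K) <= p / K, at most half of F', so the net damping \<open>a\<close> is at least
        \<open>d / 2\<close>.\<close>
      have sign: "y' t * s \<le> 0" if t: "t \<in> {1..v'}" and s: "s = 1 \<or> s = - 1" and Bs: "B < y t * s" for t s
      proof -
        define d where "d = dF (rx u t)"
        define a where "a = d + \<kappa> * F (rx u t) - p / (t + K)"
        have d: "0 < d" unfolding d_def by (intro dF_pos less_imp_le rx_gt)
        have "p / (t + K) \<le> p / K" using p K t by (intro divide_left_mono) auto
        moreover have "2 * (p / K) \<le> d"
          unfolding d_def using inS[OF t] rx_gt[of u t] by (intro damping) (auto simp: S_def)
        moreover have "0 \<le> \<kappa> * F (rx u t)"
          using \<kappa> F_pos[OF rx_gt, of u t] by simp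
        ultimately have "d / 2 \<le> a" unfolding a_def by linarith
        moreover have \<beta>y: "\<beta> < y t * s" using Bs by (simp add: B_def)
        ultimately have "d / 2 * (y t * s) \<le> a * (y t * s)"
          using \<beta>0 by (intro mult_right_mono) auto
        moreover have "d / 2 * \<beta> \<le> d / 2 * (y t * s)" using \<beta>y d by (intro mult_left_mono) auto
        moreover have "d * (g t * s) \<le> d * (\<beta> / 2)"
          using g_bound[OF t] s d by (intro mult_left_mono) auto
        moreover have "y' t * s = d * (g t * s) - a * (y t * s)"
          by (simp add: y'_def a_def d_def algebra_simps)
        ultimately show ?thesis by simp
      qed
      have damp: "y' t \<le> 0" if "t \<in> {1..v'}" "B < y t" for t
        using sign[OF that(1), of 1] that(2) by simp
      have damp': "0 \<le> y' t" if "t \<in> {1..v'}" "y t < - B" for t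
        using sign[OF that(1), of "- 1"] that(2) by simp
      have "\<bar>y v'\<bar> \<le> B"
      proof (rule damped_ode_bound[OF u(1) y_deriv _ damp damp'])
        have "exp (- (\<kappa> * (rx u 1 - rp))) \<le> 1"
          using \<kappa> rx_gt[of u 1] by simp
        moreover have "\<bar>W 1 (rx u 1) - c\<bar> \<le> D1"
          using inS[of 1] u by (intro init rx_gt) (auto simp: S_def)
        ultimately have "\<bar>y 1\<bar> \<le> (1 * w 1) * D1"
          using w[of 1] unfolding y_def Wt_def abs_mult
          by (intro mult_mono) auto
        then show "\<bar>y 1\<bar> \<le> B" by (simp add: B_def w_def)
      qed
      then show ?thesis using u by (simp add: y_def)
    qed
    have "N \<le> B"
      unfolding N_def using step by (intro cSup_least T_ne) (auto simp: T_def)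
    moreover have "\<beta> = 2 * C0 / rp + N / 2"
      using rp_pos by (simp add: \<beta>_def \<kappa>_def field_simps)
    \<comment> \<open>N <= max a (b + N / 2), with N finite, gives N <= max a (2 b); here b = 2 C0 /
      rp.\<close>
    ultimately have NB: "N \<le> max ((1 + K) powr p * D1) (4 * C0 / rp)"
      unfolding B_def by (simp add: le_max_iff_disj) argo
    have "w v * \<bar>\<Psi> v r\<bar> \<le> C0 + N * exp (\<kappa> * (r - rp)) / \<kappa>"
      by (rule \<Psi>_bound[OF vr(1) True])
    also have "\<dots> \<le> C0 + max ((1 + K) powr p * D1) (4 * C0 / rp) * exp (\<kappa> * (R - rp)) / \<kappa>"
      using NB N0 r \<kappa> by (intro add_left_mono divide_right_mono mult_mono) auto
    finally show ?thesis by (simp add: w_def \<Psi>_def \<kappa>_def)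
  qed
qed

section \<open>Values on the horizon and radial transport of d_v(r phi)\<close>

lemma tendsto_horizon:
  assumes "continuous_on ext (\<lambda>(v, r). f v r)" "1 \<le> v"
  shows "((\<lambda>u. f v (rx u v)) \<longlongrightarrow> f v rp) at_top"
proof -
  have "((\<lambda>u. (\<lambda>(v, r). f v r) (v, rx u v)) \<longlongrightarrow> (\<lambda>(v, r). f v r) (v, rp)) at_top"
  proof (rule continuous_on_tendsto_compose[OF assms(1)])
    show "((\<lambda>u. (v, rx u v)) \<longlongrightarrow> (v, rp)) at_top"
      by (intro tendsto_intros rx_tendsto_horizon)
    show "\<forall>\<^sub>F u in at_top. (v, rx u v) \<in> ext"
      using assms(2) rx_in_ext by (auto intro: eventually_at_top_linorderI[of "- U0"])
  qed (rule horizon_in_ext[OF assms(2)])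
  then show ?thesis by simp
qed

lemma Z_continuous: "continuous_on ext (\<lambda>(v, r). Z v r)"
  unfolding Z_def case_prod_unfold using rp_pos
  by (intro continuous_intros) (auto simp: ext_rx_iff)

lemma Z_horizon: "Z v rp = rp * Y v rp"
  by (simp add: Z_def F_rp)

text \<open>On the horizon \<open>d_v_at\<close> is a limit along u; the continuity of Y up to the
  horizon evaluates it.\<close>

lemma d_v_at_horizon:
  assumes "1 \<le> v" shows "d_v_at M e \<phi> v rp = Y v rp"
proof -
  have "((\<lambda>u. d_v (ext_null M e \<phi>) u v) \<longlongrightarrow> Y v rp) at_top"
  proof (rule Lim_transform_eventually[OF tendsto_horizon[OF Y_continuous assms]])
    show "\<forall>\<^sub>F u in at_top. Y v (rx u v) = d_v (ext_null M e \<phi>) u v"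
      using assms d_v_\<phi> by (auto intro: eventually_at_top_linorderI[of "- U0"])
  qed
  then show ?thesis by (simp add: d_v_at_def tendsto_Lim)
qed

lemma d_v_at_times_r:
  assumes "(v, r) \<in> ext" shows "d_v_at M e (times_r \<phi>) v r = Z v r"
proof (cases "rp < r")
  case True
  then have "rx (v - rs r) v = r" "1 \<le> v" "- U0 \<le> v - rs r"
    using assms by (auto simp: rx_rs ext_def)
  then show ?thesis using True by (simp add: d_v_at_def d_v_times_r_\<phi>)
next
  case False
  then have v: "1 \<le> v" "r = rp" using assms by (auto simp: ext_def)
  have "((\<lambda>u. d_v (ext_null M e (times_r \<phi>)) u v) \<longlongrightarrow> Z v rp) at_top"
  proof (rule Lim_transform_eventually[OF tendsto_horizon[OF Z_continuous v(1)]])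
    show "\<forall>\<^sub>F u in at_top. Z v (rx u v) = d_v (ext_null M e (times_r \<phi>)) u v"
      using v d_v_times_r_\<phi> by (auto intro: eventually_at_top_linorderI[of "- U0"])
  qed
  then show ?thesis using v by (simp add: d_v_at_def tendsto_Lim)
qed

text \<open>Chain rule with u = v - r* at fixed v, so that du/dr = -1/F. The point lies strictly
  inside \<open>ext\<close>, which makes the u-derivative two-sided.\<close>

lemma Y_has_derivative_r:
  assumes "(v, R) \<in> ext" "rp < r" "r < R"
  shows "((\<lambda>r. Y v r) has_real_derivative - G v r / F r) (at r)"
proof -
  have v: "1 \<le> v" "R \<le> rx (- U0) v" using assms by (auto simp: ext_rx_iff)
  have "rs r < v + U0"
    using rs_less_iff[OF assms(2) rx_gt[of "- U0" v]] assms v by (simp add: rs_rx)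
  then have u: "- U0 < v - rs r" by simp
  have "((\<lambda>u. Y v (rx u v)) has_real_derivative G v (rx (v - rs r) v)) (at (v - rs r) within {- U0..})"
    using u v by (intro Y_has_derivative_u) auto
  then have "((\<lambda>u. Y v (rx u v)) has_real_derivative G v r) (at (v - rs r))"
    using u assms at_within_interior[of "v - rs r" "{- U0..}"] by (simp add: rx_rs)
  moreover have "((\<lambda>r. v - rs r) has_real_derivative - (1 / F r)) (at r)"
    using rs_has_derivative[OF assms(2)] by (auto intro!: derivative_eq_intros)
  ultimately have "((\<lambda>r. Y v (rx (v - rs r) v)) has_real_derivative G v r * - (1 / F r)) (at r)"
    by (rule DERIV_chain2)
  then have "((\<lambda>r. Y v r) has_real_derivative G v r * - (1 / F r)) (at r)"
    by (rule has_field_derivative_transform_within_open[where S = "{rp<..}"])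
      (use assms in \<open>auto simp: rx_rs\<close>)
  then show ?thesis by simp
qed

text \<open>Since r G / F = F X + Y, all terms but F' phi cancel. No derivative of phi survives, so
  pointwise bounds on phi suffice to carry Z outwards.\<close>

lemma Z_has_derivative_r:
  assumes "(v, R) \<in> ext" "rp < r" "r < R"
  shows "((\<lambda>r. Z v r) has_real_derivative dF r * \<phi> (v, r)) (at r)"
proof -
  have r: "0 < r" using assms rp_pos by linarith
  have F: "F r \<noteq> 0" using F_pos[OF assms(2)] by simp
  have "((\<lambda>r. \<phi> (v, r)) has_real_derivative X v r) (at r)"
    using \<phi>_has_derivative_r[OF assms(1), of r] assms at_within_interior[of r "{rp..R}"] by simp
  note [derivative_intros] = this F_has_derivative[OF r, of UNIV] Y_has_derivative_r[OF assms]
  show ?thesis unfolding Z_def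
    by (rule derivative_eq_intros refl)+ (use r F in \<open>simp add: G_def field_simps\<close>)
qed

text \<open>The integral of F' phi is added to the value on the horizon, where F = 0 leaves Z = rp
  Y. The factor 2 M / rp^2 bounds F' for all r >= rp.\<close>

lemma Z_bound:
  assumes ext: "(v, R) \<in> ext" and bound: "\<And>r. rp \<le> r \<Longrightarrow> r \<le> R \<Longrightarrow> \<bar>\<phi> (v, r)\<bar> \<le> b"
  shows "\<bar>Z v R\<bar> \<le> rp * \<bar>Y v rp\<bar> + 2 * M / rp\<^sup>2 * b * (R - rp)"
proof (cases "rp < R")
  case True
  have "norm (Z v R - Z v rp) \<le> 2 * M / rp\<^sup>2 * b * R - 2 * M / rp\<^sup>2 * b * rp"
  proof (rule differentiable_bound_general[OF True])
    show "continuous_on {rp..R} (Z v)"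
      using ext_slice[OF ext] by (intro compose_continuous[OF Z_continuous] continuous_intros) auto
    show "continuous_on {rp..R} (\<lambda>r. 2 * M / rp\<^sup>2 * b * r)" by (intro continuous_intros)
    fix r assume r: "rp < r" "r < R"
    show "(Z v has_vector_derivative dF r * \<phi> (v, r)) (at r)"
      using Z_has_derivative_r[OF ext r] by (simp add: has_real_derivative_iff_has_vector_derivative)
    show "((\<lambda>r. 2 * M / rp\<^sup>2 * b * r) has_vector_derivative 2 * M / rp\<^sup>2 * b) (at r)"
      unfolding has_real_derivative_iff_has_vector_derivative[symmetric]
      by (auto intro!: derivative_eq_intros)
    have "dF r \<le> 2 * M / r\<^sup>2" using r rp_pos by (simp add: dF_def)
    also have "\<dots> \<le> 2 * M / rp\<^sup>2"
      using r rp_pos M_pos by (intro divide_left_mono power_mono) auto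
    finally have "\<bar>dF r\<bar> * \<bar>\<phi> (v, r)\<bar> \<le> 2 * M / rp\<^sup>2 * b"
      using bound[of r] r dF_pos[of r] M_pos by (intro mult_mono) auto
    then show "norm (dF r * \<phi> (v, r)) \<le> 2 * M / rp\<^sup>2 * b"
      by (simp only: real_norm_def abs_mult)
  qed
  also have "\<dots> = 2 * M / rp\<^sup>2 * b * (R - rp)" by (simp only: right_diff_distrib)
  finally have "\<bar>Z v R\<bar> \<le> \<bar>Z v rp\<bar> + 2 * M / rp\<^sup>2 * b * (R - rp)"
    unfolding real_norm_def by linarith
  then show ?thesis using rp_pos by (simp add: Z_horizon abs_mult)
next
  case False
  then have "R = rp" using ext by (auto simp: ext_rx_iff)
  then show ?thesis using rp_pos by (simp add: Z_horizon abs_mult)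
qed

end

section \<open>Energy and decay\<close>

locale exterior_solution_data = exterior_solution +
  fixes D :: real
  assumes D_pos: "0 < D" and data: "data_bounds M e U0 D \<phi>"
begin

section \<open>Pointwise data and the conserved flux\<close>

lemma rx_F_pos [simp]: "0 < F (rx u v)"
  by (rule F_pos[OF rx_gt])

lemma data_Y: "1 \<le> v \<Longrightarrow> (rx (- U0) v)\<^sup>2 * \<bar>Y v (rx (- U0) v)\<bar> \<le> D * F (rx (- U0) v)"
  using data unfolding data_bounds_def
  by (auto simp: d_v_\<phi> d_v_rx abs_div abs_of_pos pos_divide_le_eq)

lemma data_Z: "1 \<le> v \<Longrightarrow> rx (- U0) v ^ 3 * \<bar>Z v (rx (- U0) v)\<bar> \<le> D * F (rx (- U0) v)"
  using data unfolding data_bounds_def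
  by (auto simp: d_v_times_r_\<phi> d_v_rx abs_div abs_of_pos pos_divide_le_eq)

lemma rx_F_neq_0 [simp]: "F (rx u v) \<noteq> 0"
  by (rule less_imp_neq[OF rx_F_pos, symmetric])

lemma rx_F_square_le: "(F (rx u v))\<^sup>2 \<le> F (rx u v)"
  using mult_left_le[of "F (rx u v)" "F (rx u v)"] F_le_1 rx_gt[of u v] rx_F_pos[of u v]
  by (simp add: power2_eq_square less_imp_le del: rx_F_pos)

lemma data_X: "- U0 \<le> u \<Longrightarrow> \<bar>X 1 (rx u 1)\<bar> \<le> D"
  using data unfolding data_bounds_def by (auto simp: d_u_\<phi> d_u_rx)

lemma data_W: "- U0 \<le> u \<Longrightarrow> \<bar>\<phi> (1, rx u 1) + rx u 1 * X 1 (rx u 1)\<bar> \<le> D"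
  using data unfolding data_bounds_def by (auto simp: d_u_times_r_\<phi> d_u_rx)

text \<open>Conservation of the energy of the static Killing field. In each of the two derivatives
  the term from differentiating r cancels one of the two terms of G, leaving 2 r F^2 X Y with
  opposite signs.\<close>

lemma flux_identity:
  assumes "- U0 \<le> u" "1 \<le> v"
  shows "integral {1..v} (\<lambda>v. (rx u v * Y v (rx u v))\<^sup>2)
      + integral {- U0..u} (\<lambda>u. (rx u v * (F (rx u v) * X v (rx u v)))\<^sup>2)
    = integral {1..v} (\<lambda>v. (rx (- U0) v * Y v (rx (- U0) v))\<^sup>2)
      + integral {- U0..u} (\<lambda>u. (rx u 1 * (F (rx u 1) * X 1 (rx u 1)))\<^sup>2)"
proof -
  let ?A = "\<lambda>u v. (rx u v * Y v (rx u v))\<^sup>2"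
  let ?B = "\<lambda>u v. (rx u v * (F (rx u v) * X v (rx u v)))\<^sup>2"
  let ?k = "\<lambda>u v. - 2 * rx u v * (F (rx u v))\<^sup>2 * Y v (rx u v) * X v (rx u v)"
  show ?thesis
  proof (rule conserved_flux_identity[where A = ?A and B = ?B and k = ?k])
    fix u' v' assume uv': "u' \<in> {- U0..u}" "v' \<in> {1..v}"
    then have uv: "- U0 \<le> u'" "1 \<le> v'" by auto
    have "((\<lambda>u. ?A u v') has_real_derivative - ?k u' v') (at u' within {- U0..})"
      by (rule derivative_eq_intros rx_has_derivative_u Y_has_derivative_u uv refl)+
        (use rx_pos[of u' v'] in \<open>simp add: G_def field_simps power2_eq_square\<close>)
    then show "((\<lambda>u. ?A u v') has_real_derivative - ?k u' v') (at u' within {- U0..u})"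
      by (rule has_field_derivative_subset) auto
    \<comment> \<open>Inside the square the sign is free; this one exposes d_u phi = -F X, whose
      v-derivative is known.\<close>
    have *: "?B u' = (\<lambda>v. (rx u' v * (- F (rx u' v) * X v (rx u' v)))\<^sup>2)"
      by simp
    have "(?B u' has_real_derivative ?k u' v') (at v' within {1..})"
      unfolding *
      by (rule derivative_eq_intros rx_has_derivative_v u_derivative_has_derivative_v uv refl)+
        (use rx_pos[of u' v'] in \<open>simp add: G_def field_simps power2_eq_square\<close>)
    then show "(?B u' has_real_derivative ?k u' v') (at v' within {1..v})"
      by (rule has_field_derivative_subset) auto
  next
    show "continuous_on ({- U0..u} \<times> {1..v}) (\<lambda>(u, v). ?k u v)"
      unfolding case_prod_unfold using rx_in_ext by (intro continuous_intros) (auto simp: rx_pos)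
    show "continuous_on {1..v} (?A u')" if "u' \<in> {- U0..u}" for u'
      using that rx_in_ext by (intro continuous_intros) auto
    show "continuous_on {- U0..u} (\<lambda>u. ?B u v')" if "v' \<in> {1..v}" for v'
      using that rx_in_ext by (intro continuous_intros) (auto simp: rx_pos)
  qed (use assms in auto)
qed

lemma initial_flux_v:
  assumes "1 \<le> v"
  shows "integral {1..v} (\<lambda>v. (rx (- U0) v * Y v (rx (- U0) v))\<^sup>2) \<le> D\<^sup>2 / rp"
proof -
  let ?r = "rx (- U0)"
  \<comment> \<open>The data bound the integrand by D^2 F^2 / r^2 <= D^2 F / r^2, which is the
    v-derivative of -D^2 / r.\<close>
  have "integral {1..v} (\<lambda>v. (?r v * Y v (?r v))\<^sup>2) \<le> - D\<^sup>2 / ?r v - - D\<^sup>2 / ?r 1"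
  proof (rule integral_le_diff[OF assms])
    show "continuous_on {1..v} (\<lambda>v. (?r v * Y v (?r v))\<^sup>2)"
      using rx_in_ext by (intro continuous_intros) auto
    show "((\<lambda>v. - D\<^sup>2 / ?r v) has_real_derivative D\<^sup>2 * F (?r x) / (?r x)\<^sup>2) (at x within {1..v})" for x
      by (rule derivative_eq_intros rx_has_derivative_v refl)+
        (use rx_pos[of "- U0" x] in \<open>auto simp: field_simps power2_eq_square\<close>)
    fix x assume x: "x \<in> {1..v}"
    have r: "0 < ?r x" by (rule rx_pos)
    have "\<bar>?r x * Y x (?r x)\<bar> = (?r x)\<^sup>2 * \<bar>Y x (?r x)\<bar> / ?r x"
      using r by (simp add: abs_mult field_simps power2_eq_square)
    also have "\<dots> \<le> D * F (?r x) / ?r x"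
      using x r by (intro divide_right_mono data_Y) auto
    finally have "\<bar>?r x * Y x (?r x)\<bar>\<^sup>2 \<le> (D * F (?r x) / ?r x)\<^sup>2"
      by (rule power_mono) simp
    also have "\<dots> = D\<^sup>2 * (F (?r x))\<^sup>2 / (?r x)\<^sup>2" by (simp add: power_mult_distrib power_divide)
    also have "\<dots> \<le> D\<^sup>2 * F (?r x) / (?r x)\<^sup>2"
      by (intro divide_right_mono mult_left_mono rx_F_square_le) auto
    finally show "(?r x * Y x (?r x))\<^sup>2 \<le> D\<^sup>2 * F (?r x) / (?r x)\<^sup>2" by simp
  qed
  also have "\<dots> \<le> D\<^sup>2 / ?r 1" using rx_pos[of "- U0" v] by simp
  also have "\<dots> \<le> D\<^sup>2 / rp"
    using rx_gt[of "- U0" 1] rp_pos by (intro divide_left_mono) auto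
  finally show ?thesis .
qed

lemma initial_flux_u:
  assumes "- U0 \<le> u"
  shows "integral {- U0..u} (\<lambda>u. (rx u 1 * (F (rx u 1) * X 1 (rx u 1)))\<^sup>2) \<le> D\<^sup>2 * rx (- U0) 1 ^ 3"
proof -
  let ?r1 = "rx (- U0) 1"
  \<comment> \<open>Here r <= \<open>?r1\<close> because r decreases in u, and F^2 <= F = -d_u
    r.\<close>
  have "integral {- U0..u} (\<lambda>u. (rx u 1 * (F (rx u 1) * X 1 (rx u 1)))\<^sup>2)
    \<le> - (D\<^sup>2 * ?r1\<^sup>2) * rx u 1 - - (D\<^sup>2 * ?r1\<^sup>2) * rx (- U0) 1"
  proof (rule integral_le_diff[OF assms])
    show "continuous_on {- U0..u} (\<lambda>u. (rx u 1 * (F (rx u 1) * X 1 (rx u 1)))\<^sup>2)"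
      using rx_in_ext by (intro continuous_intros) (auto simp: rx_pos)
    show "((\<lambda>u. - (D\<^sup>2 * ?r1\<^sup>2) * rx u 1) has_real_derivative D\<^sup>2 * ?r1\<^sup>2 * F (rx x 1)) (at x within {- U0..u})" for x
      by (rule derivative_eq_intros rx_has_derivative_u refl)+ simp
    fix x assume x: "x \<in> {- U0..u}"
    have r: "0 < rx x 1" by (rule rx_pos)
    have "\<bar>rx x 1 * (F (rx x 1) * X 1 (rx x 1))\<bar> = rx x 1 * F (rx x 1) * \<bar>X 1 (rx x 1)\<bar>"
      using r by (simp add: abs_mult less_imp_le)
    also have "\<dots> \<le> ?r1 * F (rx x 1) * D"
      using r x data_X rx_antimono_u[of "- U0" x 1] rx_pos[of "- U0" 1]
      by (intro mult_mono) (auto simp: less_imp_le)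
    finally have "\<bar>rx x 1 * (F (rx x 1) * X 1 (rx x 1))\<bar>\<^sup>2 \<le> (?r1 * F (rx x 1) * D)\<^sup>2"
      by (rule power_mono) simp
    also have "\<dots> = D\<^sup>2 * ?r1\<^sup>2 * (F (rx x 1))\<^sup>2" by (simp add: power_mult_distrib)
    also have "\<dots> \<le> D\<^sup>2 * ?r1\<^sup>2 * F (rx x 1)"
      by (intro mult_left_mono rx_F_square_le) auto
    finally show "(rx x 1 * (F (rx x 1) * X 1 (rx x 1)))\<^sup>2 \<le> D\<^sup>2 * ?r1\<^sup>2 * F (rx x 1)" by simp
  qed
  also have "\<dots> \<le> D\<^sup>2 * ?r1\<^sup>2 * ?r1" using rx_pos[of u 1] by simp
  finally show ?thesis by (simp add: power2_eq_square power3_eq_cube mult.assoc)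
qed

text \<open>Only its being independent of u and v matters: it enters the proof of c = 0 and not the
  final constant.\<close>

definition energy :: real where "energy = D\<^sup>2 / rp + D\<^sup>2 * rx (- U0) 1 ^ 3"

lemma flux_bounds:
  assumes "- U0 \<le> u" "1 \<le> v"
  shows "integral {1..v} (\<lambda>v. (rx u v * Y v (rx u v))\<^sup>2) \<le> energy"
    and "integral {- U0..u} (\<lambda>u. (rx u v * (F (rx u v) * X v (rx u v)))\<^sup>2) \<le> energy"
proof -
  have "0 \<le> integral {1..v} (\<lambda>v. (rx u v * Y v (rx u v))\<^sup>2)"
    "0 \<le> integral {- U0..u} (\<lambda>u. (rx u v * (F (rx u v) * X v (rx u v)))\<^sup>2)"
    using assms rx_in_ext
    by (intro integral_nonneg integrable_continuous_real continuous_intros; simp add: rx_pos)+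
  with flux_identity[OF assms] initial_flux_v[OF assms(2)] initial_flux_u[OF assms(1)]
  show "integral {1..v} (\<lambda>v. (rx u v * Y v (rx u v))\<^sup>2) \<le> energy"
    "integral {- U0..u} (\<lambda>u. (rx u v * (F (rx u v) * X v (rx u v)))\<^sup>2) \<le> energy"
    unfolding energy_def by linarith+
qed

text \<open>The data give |d_v(r phi)| <= D F / r^3, the v-derivative of -D / (2 r^2). So r phi
  stays bounded and phi = O(1/r); this is what a nonzero constant violates.\<close>

lemma \<phi>_vanishes_initially: "((\<lambda>v. \<phi> (v, rx (- U0) v)) \<longlongrightarrow> 0) at_top"
proof -
  let ?r = "rx (- U0)"
  define B where "B = \<bar>?r 1 * \<phi> (1, ?r 1)\<bar> + D / 2 / (?r 1)\<^sup>2"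
  have "\<bar>\<phi> (v, ?r v)\<bar> \<le> B / ?r v" if v: "1 \<le> v" for v
  proof -
    have rpos: "0 < ?r x" for x by (rule rx_pos)
    have cont: "continuous_on {1..v} (\<lambda>v. D * F (?r v) / ?r v ^ 3)"
      using rpos by (intro continuous_intros) (auto simp: less_imp_neq[OF rpos, symmetric])
    have "\<bar>?r v * \<phi> (v, ?r v) - ?r 1 * \<phi> (1, ?r 1)\<bar> \<le> integral {1..v} (\<lambda>v. D * F (?r v) / ?r v ^ 3)"
    proof (rule abs_diff_le_integral[OF v cont])
      fix x assume x: "x \<in> {1..v}"
      have "((\<lambda>v. ?r v * \<phi> (v, ?r v)) has_real_derivative Z x (?r x)) (at x within {1..})"
        unfolding Z_def using x
        by (auto intro!: derivative_eq_intros rx_has_derivative_v \<phi>_has_derivative_v)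
      then show "((\<lambda>v. ?r v * \<phi> (v, ?r v)) has_real_derivative Z x (?r x)) (at x within {1..v})"
        by (rule has_field_derivative_subset) auto
      show "\<bar>Z x (?r x)\<bar> \<le> D * F (?r x) / ?r x ^ 3"
        using data_Z[of x] x rpos[of x] by (simp add: pos_le_divide_eq mult.commute)
    qed
    also have "\<dots> \<le> - (D / 2) / (?r v)\<^sup>2 - - (D / 2) / (?r 1)\<^sup>2"
    proof (rule integral_le_diff[OF v cont])
      show "((\<lambda>v. - (D / 2) / (?r v)\<^sup>2) has_real_derivative D * F (?r x) / ?r x ^ 3) (at x within {1..v})" for x
        by (rule derivative_eq_intros rx_has_derivative_v refl)+
          (use rpos[of x] in \<open>auto simp: field_simps power2_eq_square power3_eq_cube\<close>)
    qed simp
    also have "\<dots> \<le> D / 2 / (?r 1)\<^sup>2" using D_pos by simp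
    finally have "\<bar>?r v * \<phi> (v, ?r v)\<bar> \<le> B" unfolding B_def by linarith
    then show ?thesis using rpos[of v] by (simp add: abs_mult pos_le_divide_eq mult.commute)
  qed
  then have "\<forall>\<^sub>F v in at_top. norm (\<phi> (v, ?r v)) \<le> B / ?r v"
    by (auto intro: eventually_at_top_linorderI[of 1])
  moreover have "((\<lambda>v. B / ?r v) \<longlongrightarrow> 0) at_top"
    by (rule real_tendsto_divide_at_top[OF tendsto_const rx_at_top])
  ultimately show ?thesis by (rule Lim_null_comparison)
qed

text \<open>Compare with the initial curve along fixed v. By Young, r |d_u phi| is at most half of
  the flux density plus 1/2, and the u-interval is bounded; as r is smallest at its end u, the
  difference is O(1 / \<open>rx u v\<close>).\<close>

lemma \<phi>_vanishes_at_null_infinity: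
  assumes u: "- U0 \<le> u"
  shows "((\<lambda>v. \<phi> (v, rx u v)) \<longlongrightarrow> 0) at_top"
proof -
  have "\<bar>\<phi> (v, rx u v) - \<phi> (v, rx (- U0) v)\<bar> \<le> (energy + (u + U0)) / (2 * rx u v)" if v: "1 \<le> v" for v
  proof -
    let ?H = "\<lambda>u. F (rx u v) * X v (rx u v)"
    let ?g = "\<lambda>x. 1 / (2 * rx u v) * ((rx x v * ?H x)\<^sup>2 + 1)"
    have cont: "continuous_on {- U0..u} (\<lambda>x. (rx x v * ?H x)\<^sup>2)"
      using rx_in_ext v by (intro continuous_intros) (auto simp: rx_pos)
    have "\<bar>\<phi> (v, rx u v) - \<phi> (v, rx (- U0) v)\<bar> \<le> integral {- U0..u} ?g"
    proof (rule abs_diff_le_integral[OF u])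
      show "continuous_on {- U0..u} ?g" by (intro continuous_intros cont)
      fix x assume x: "x \<in> {- U0..u}"
      show "((\<lambda>u. \<phi> (v, rx u v)) has_real_derivative - F (rx x v) * X v (rx x v)) (at x within {- U0..u})"
        using x v by (intro has_field_derivative_subset[OF \<phi>_has_derivative_u]) auto
      have "\<bar>- F (rx x v) * X v (rx x v)\<bar> * rx u v \<le> \<bar>- F (rx x v) * X v (rx x v)\<bar> * rx x v"
        using x by (intro mult_left_mono rx_antimono_u) auto
      also have "\<dots> = \<bar>rx x v * ?H x\<bar>"
        using rx_pos[of x v] by (simp add: abs_mult)
      also have "\<dots> \<le> ((rx x v * ?H x)\<^sup>2 + 1) / 2"
        using young_ineq[of 1 "rx x v * ?H x" 1] by simp
      finally show "\<bar>- F (rx x v) * X v (rx x v)\<bar> \<le> ?g x"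
        using rx_pos[of u v] by (simp add: field_simps)
    qed
    also have "integral {- U0..u} ?g = 1 / (2 * rx u v) * (integral {- U0..u} (\<lambda>x. (rx x v * ?H x)\<^sup>2) + (u + U0))"
      using u by (simp only: integral_mult_right integral_add[OF integrable_continuous_real[OF cont] integrable_const_ivl])
        simp
    also have "\<dots> \<le> 1 / (2 * rx u v) * (energy + (u + U0))"
      using flux_bounds(2)[OF u v] rx_pos[of u v] by (intro mult_left_mono) auto
    finally show ?thesis by simp
  qed
  then have "\<forall>\<^sub>F v in at_top. norm (\<phi> (v, rx u v) - \<phi> (v, rx (- U0) v)) \<le> (energy + (u + U0)) / (2 * rx u v)"
    by (auto intro: eventually_at_top_linorderI[of 1])
  moreover have "((\<lambda>v. (energy + (u + U0)) / (2 * rx u v)) \<longlongrightarrow> 0) at_top"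
    by (intro real_tendsto_divide_at_top[OF tendsto_const] filterlim_tendsto_pos_mult_at_top[OF tendsto_const _ rx_at_top]) auto
  ultimately have "((\<lambda>v. \<phi> (v, rx u v) - \<phi> (v, rx (- U0) v)) \<longlongrightarrow> 0) at_top"
    by (rule Lim_null_comparison)
  from tendsto_add[OF this \<phi>_vanishes_initially] show ?thesis by simp
qed

text \<open>Integrate Y along fixed u from null infinity. The flux controls the integral of r^2 Y^2,
  and F >= 1/2 for r >= 4 M turns the remaining integral of 1/r^2 dv into one in dr, of size
  1/r.\<close>

lemma \<phi>_radial_decay:
  assumes ext: "(v, r) \<in> ext" and r: "4 * M \<le> r"
  shows "\<bar>\<phi> (v, r)\<bar> \<le> (energy / 2 + 1) / sqrt r"
proof -
  have rp: "rp < r" using r rm_pos rp_plus_rm M_pos by linarith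
  obtain u where u: "1 \<le> v" "- U0 \<le> u" "r = rx u v"
    by (rule ext_exteriorE[OF ext rp])
  have r0: "0 < r" using r M_pos by linarith
  have bound: "\<bar>\<phi> (V, rx u V) - \<phi> (v, r)\<bar> \<le> (energy / 2 + 1) / sqrt r" if V: "v \<le> V" for V
  proof -
    \<comment> \<open>Balances \<open>\<eta>\<close> times the energy against 1 /
      (\<open>\<eta>\<close> r).\<close>
    define \<eta> where "\<eta> = 1 / sqrt r"
    have \<eta>: "0 < \<eta>" using r0 by (simp add: \<eta>_def)
    let ?A = "\<lambda>x. (rx u x * Y x (rx u x))\<^sup>2"
    let ?h = "\<lambda>x. F (rx u x) / (rx u x)\<^sup>2"
    have contA: "continuous_on {1..V} ?A"
      using rx_in_ext u by (intro continuous_intros) auto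
    have contA': "continuous_on {v..V} ?A"
      using u by (intro continuous_on_subset[OF contA]) auto
    have conth: "continuous_on {v..V} ?h"
      by (intro continuous_intros) (auto simp: rx_pos less_imp_neq[OF rx_pos, symmetric])
    have "\<bar>\<phi> (V, rx u V) - \<phi> (v, rx u v)\<bar> \<le> integral {v..V} (\<lambda>x. \<eta> / 2 * ?A x + 1 / \<eta> * ?h x)"
    proof (rule abs_diff_le_integral[OF V])
      show "continuous_on {v..V} (\<lambda>x. \<eta> / 2 * ?A x + 1 / \<eta> * ?h x)"
        by (intro continuous_intros contA' conth)
      fix x assume x: "x \<in> {v..V}"
      show "((\<lambda>v. \<phi> (v, rx u v)) has_real_derivative Y x (rx u x)) (at x within {v..V})"
        using x u by (intro has_field_derivative_subset[OF \<phi>_has_derivative_v]) auto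
      have rr: "4 * M \<le> rx u x" "0 < rx u x" using rx_mono_v[of v x u] x r u rx_pos by auto
      have half: "1 \<le> 2 * (1 - a + b)" if "a \<le> 1 / 2" "0 \<le> b" for a b :: real
        using that by (simp add: algebra_simps)
      have "2 * M / rx u x \<le> 1 / 2" using rr by (simp add: field_simps)
      then have "1 \<le> 2 * F (rx u x)" unfolding F_def by (rule half) simp
      then have "1 * (1 / (rx u x)\<^sup>2) \<le> (2 * F (rx u x)) * (1 / (rx u x)\<^sup>2)"
        by (intro mult_right_mono) auto
      then have "1 / (2 * \<eta>) * (1 / rx u x)\<^sup>2 \<le> 1 / (2 * \<eta>) * (2 * ?h x)"
        using \<eta> by (intro mult_left_mono) (auto simp: power_divide)
      then have "1 / (2 * \<eta>) * (1 / rx u x)\<^sup>2 \<le> 1 / \<eta> * ?h x" by simp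
      moreover have "\<bar>Y x (rx u x)\<bar> \<le> \<eta> / 2 * ?A x + 1 / (2 * \<eta>) * (1 / rx u x)\<^sup>2"
        using young_ineq[OF \<eta>, of "rx u x * Y x (rx u x)" "1 / rx u x"] rr by simp
      ultimately show "\<bar>Y x (rx u x)\<bar> \<le> \<eta> / 2 * ?A x + 1 / \<eta> * ?h x" by linarith
    qed
    also have "\<dots> = \<eta> / 2 * integral {v..V} ?A + 1 / \<eta> * integral {v..V} ?h"
      using integrable_continuous_real[OF contA'] integrable_continuous_real[OF conth]
      by (simp only: integral_add integrable_on_mult_right integral_mult_right)
    also have "\<dots> \<le> \<eta> / 2 * energy + 1 / \<eta> * (1 / r)"
    proof (intro add_mono mult_left_mono)
      have "integral {v..V} ?A \<le> integral {1..V} ?A"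
        using u V contA contA' by (intro integral_subset_le integrable_continuous_real) auto
      also have "\<dots> \<le> energy" using flux_bounds(1) u V by simp
      finally show "integral {v..V} ?A \<le> energy" .
      have "integral {v..V} ?h \<le> - 1 / rx u V - - 1 / rx u v"
      proof (rule integral_le_diff[OF V conth])
        show "((\<lambda>x. - 1 / rx u x) has_real_derivative ?h x) (at x within {v..V})" for x
          by (rule derivative_eq_intros rx_has_derivative_v refl)+
            (use rx_pos[of u x] in \<open>auto simp: field_simps power2_eq_square\<close>)
      qed simp
      also have "\<dots> \<le> 1 / r" using rx_pos[of u V] u by simp
      finally show "integral {v..V} ?h \<le> 1 / r" .
    qed (use \<eta> in auto)
    also have "\<dots> = (energy / 2 + 1) / sqrt r"
      unfolding \<eta>_def using r0 real_sqrt_mult_self[of r] by (simp add: field_simps)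
    finally show ?thesis using u by simp
  qed
  have "((\<lambda>V. \<bar>\<phi> (V, rx u V) - \<phi> (v, r)\<bar>) \<longlongrightarrow> \<bar>0 - \<phi> (v, r)\<bar>) at_top"
    by (intro tendsto_intros \<phi>_vanishes_at_null_infinity u)
  then have "\<bar>0 - \<phi> (v, r)\<bar> \<le> (energy / 2 + 1) / sqrt r"
    by (rule tendsto_upperbound) (use bound in \<open>auto intro: eventually_at_top_linorderI[of v]\<close>)
  then show ?thesis by simp
qed

section \<open>Consequences of a decay rate on the horizon\<close>

lemma W_initial: "(1, r) \<in> ext \<Longrightarrow> rp < r \<Longrightarrow> \<bar>W 1 r\<bar> \<le> D"
  unfolding W_def by (elim ext_exteriorE) (auto simp: data_W)

text \<open>Translates \<open>weighted_bound\<close> from (v + K)^p to v^p. The limit c is kept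
  general because it is not yet known to vanish; it costs |c| in the initial bound for W -
  c.\<close>

lemma decay_from_horizon:
  assumes p: "0 < p" and K: "0 < K" and damping: "\<And>r. rp \<le> r \<Longrightarrow> r \<le> R \<Longrightarrow> 2 * (p / K) \<le> dF r"
    and C: "0 \<le> C" and horizon: "\<And>v. 1 \<le> v \<Longrightarrow> \<bar>\<phi> (v, rp) - c\<bar> \<le> C * v powr - p"
    and ext: "(v, r) \<in> ext" and r: "r \<le> R"
  shows "\<bar>\<phi> (v, r) - c\<bar> \<le> decay_const p K R C (D + \<bar>c\<bar>) * v powr - p"
proof -
  have v: "1 \<le> v" "rp \<le> r" using ext by (auto simp: ext_rx_iff)
  have "(v' + K) powr p * \<bar>rp * (\<phi> (v', rp) - c)\<bar> \<le> rp * C * (1 + K) powr p" if v': "1 \<le> v'" for v'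
  proof -
    \<comment> \<open>For v >= 1 the shift by K costs only the factor (1 + K)^p.\<close>
    have "v' + K \<le> v' * (1 + K)" using v' K by (simp add: algebra_simps mult_le_cancel_right1)
    then have "(v' + K) powr p \<le> (v' * (1 + K)) powr p" using v' K p by (intro powr_mono2) auto
    also have "\<dots> = v' powr p * (1 + K) powr p" using v' K by (simp add: powr_mult)
    finally have "(v' + K) powr p * (rp * \<bar>\<phi> (v', rp) - c\<bar>)
        \<le> (v' powr p * (1 + K) powr p) * (rp * (C * v' powr - p))"
      using horizon[OF v'] rp_pos v' C by (intro mult_mono mult_left_mono) auto
    also have "\<dots> = rp * C * (1 + K) powr p" using v' by (simp add: powr_minus field_simps)
    finally show ?thesis using rp_pos by (simp add: abs_mult)
  qed
  moreover have "\<bar>W 1 r' - c\<bar> \<le> D + \<bar>c\<bar>" if "(1, r') \<in> ext" "rp < r'" for r'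
    using W_initial[OF that] by linarith
  ultimately have "(v + K) powr p * \<bar>r * (\<phi> (v, r) - c)\<bar> \<le> rp * C * (1 + K) powr p
      + max ((1 + K) powr p * (D + \<bar>c\<bar>)) (4 * (rp * C * (1 + K) powr p) / rp)
        * exp (4 / rp * (R - rp)) * (rp / 4)"
    by (intro weighted_bound[OF p K damping _ _ ext r]) auto
  also have "\<dots> = rp * decay_const p K R C (D + \<bar>c\<bar>)"
    using rp_pos by (simp add: decay_const_def)
  finally have *: "(v + K) powr p * \<bar>r * (\<phi> (v, r) - c)\<bar> \<le> rp * decay_const p K R C (D + \<bar>c\<bar>)" .
  have "v powr p * (rp * \<bar>\<phi> (v, r) - c\<bar>) \<le> (v + K) powr p * (r * \<bar>\<phi> (v, r) - c\<bar>)"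
    using v K p rp_pos by (intro mult_mono powr_mono2 mult_right_mono) auto
  also have "\<dots> \<le> rp * decay_const p K R C (D + \<bar>c\<bar>)"
    using * v rp_pos by (simp add: abs_mult)
  finally have "rp * (v powr p * \<bar>\<phi> (v, r) - c\<bar>) \<le> rp * decay_const p K R C (D + \<bar>c\<bar>)"
    by (simp add: mult.left_commute)
  then have "v powr p * \<bar>\<phi> (v, r) - c\<bar> \<le> decay_const p K R C (D + \<bar>c\<bar>)"
    using rp_pos by (simp only: mult_le_cancel_left_pos)
  then show ?thesis using v by (simp add: powr_minus field_simps)
qed

text \<open>
  A limit \<open>c\<close> along the horizon is the limit along every curve of constant \<open>r\<close>, whereas
  boundedness of the energy forces the latter limits to be \<open>O(r\<^sup>-\<^sup>1\<^sup>/\<^sup>2)\<close>.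
\<close>

lemma horizon_limit_zero:
  assumes p: "0 < p" and C: "0 \<le> C"
    and horizon: "\<And>v. 1 \<le> v \<Longrightarrow> \<bar>\<phi> (v, rp) - c\<bar> \<le> C * v powr - p"
  shows "c = 0"
proof -
  have bound: "\<bar>c\<bar> \<le> (energy / 2 + 1) / sqrt R" if R: "4 * M \<le> R" for R
  proof -
    have rpR: "rp < R" using R rm_pos rp_plus_rm M_pos by linarith
    \<comment> \<open>K and the decay constant depend on R. This is harmless: v tends to infinity at
      fixed R, and R tends to infinity only in the bound for |c|.\<close>
    obtain K where K: "0 < K" "\<And>r. rp \<le> r \<Longrightarrow> r \<le> R \<Longrightarrow> 2 * (p / K) \<le> dF r"
      using red_shift_lower_bound[OF p, of R] rpR by auto
    define v0 where "v0 = max 1 (rs R - U0)"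
    have ext: "(v, R) \<in> ext" if "v0 \<le> v" for v
      using that rpR by (auto simp: v0_def ext_def)
    have "((\<lambda>v. decay_const p K R C (D + \<bar>c\<bar>) * v powr - p) \<longlongrightarrow> 0) at_top"
      using tendsto_mult_right_zero[OF tendsto_neg_powr[OF _ filterlim_ident], of "- p"] p by simp
    moreover have "\<forall>\<^sub>F v in at_top. norm (\<phi> (v, R) - c) \<le> decay_const p K R C (D + \<bar>c\<bar>) * v powr - p"
      using decay_from_horizon[OF p K C horizon ext]
      by (auto intro: eventually_at_top_linorderI[of v0])
    ultimately have "((\<lambda>v. \<phi> (v, R) - c) \<longlongrightarrow> 0) at_top"
      by (rule Lim_null_comparison[rotated])
    from tendsto_add[OF this tendsto_const[of c]]
    have "((\<lambda>v. \<bar>\<phi> (v, R)\<bar>) \<longlongrightarrow> \<bar>c\<bar>) at_top"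
      by (intro tendsto_rabs) simp
    then show ?thesis
      by (rule tendsto_upperbound)
        (use \<phi>_radial_decay[OF ext R] in \<open>auto intro: eventually_at_top_linorderI[of v0]\<close>)
  qed
  have "((\<lambda>R. (energy / 2 + 1) / sqrt R) \<longlongrightarrow> 0) at_top"
    by (rule real_tendsto_divide_at_top[OF tendsto_const sqrt_at_top])
  then have "\<bar>c\<bar> \<le> 0"
    by (rule tendsto_lowerbound) (use bound in \<open>auto intro: eventually_at_top_linorderI[of "4 * M"]\<close>)
  then show ?thesis by simp
qed

lemma decay_from_horizon_flux:
  assumes \<epsilon>: "0 < \<epsilon>" and A: "0 \<le> A" and K: "0 < K"
    and damping: "\<And>r. rp \<le> r \<Longrightarrow> r \<le> R \<Longrightarrow> 2 * ((3 + \<epsilon> / 2) / K) \<le> dF r"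
    and flux: "(\<integral>\<^sup>+v\<in>{1..}. ennreal (v powr (7 + \<epsilon>) * (d_v_at M e \<phi> v rp)\<^sup>2) \<partial>lborel) \<le> ennreal A"
    and ext: "(v, r) \<in> ext" and r: "r \<le> R"
  shows "\<bar>\<phi> (v, r)\<bar> \<le> decay_const (3 + \<epsilon> / 2) K R ((A + 1 / (6 + \<epsilon>)) / 2) D * v powr - (3 + \<epsilon> / 2)"
proof -
  define C where "C = (A + 1 / (6 + \<epsilon>)) / 2"
  have C: "0 \<le> C" using A \<epsilon> by (simp add: C_def)
  have p: "0 < 3 + \<epsilon> / 2" using \<epsilon> by simp
  have "(\<integral>\<^sup>+v\<in>{1..}. ennreal (v powr (7 + \<epsilon>) * (d_v_at M e \<phi> v rp)\<^sup>2) \<partial>lborel)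
      = (\<integral>\<^sup>+v\<in>{1..}. ennreal (v powr (7 + \<epsilon>) * (Y v rp)\<^sup>2) \<partial>lborel)"
    by (intro nn_integral_cong) (auto simp: indicator_def d_v_at_horizon)
  then have L2: "(\<integral>\<^sup>+v\<in>{1..}. ennreal (v powr (7 + \<epsilon>) * (Y v rp)\<^sup>2) \<partial>lborel) \<le> ennreal A"
    using flux by simp
  have cont: "continuous_on {1..} (\<lambda>v. Y v rp)"
    using horizon_in_ext by (intro continuous_intros) auto
  obtain c where "\<And>v. 1 \<le> v \<Longrightarrow> \<bar>\<phi> (v, rp) - c\<bar> \<le> (A + 1 / (7 + \<epsilon> - 1)) / 2 * v powr - ((7 + \<epsilon> - 1) / 2)"
    using weighted_L2_tail[OF _ A \<phi>_has_derivative_horizon cont L2] \<epsilon> by auto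
  moreover have "(7 + \<epsilon> - 1) / 2 = 3 + \<epsilon> / 2" "7 + \<epsilon> - 1 = 6 + \<epsilon>" by simp_all
  ultimately have c: "\<And>v. 1 \<le> v \<Longrightarrow> \<bar>\<phi> (v, rp) - c\<bar> \<le> C * v powr - (3 + \<epsilon> / 2)"
    by (simp only: C_def)
  \<comment> \<open>Now the propagation is repeated with c = 0, so that the constant contains D in
    place of D + |c|.\<close>
  have "c = 0" by (rule horizon_limit_zero[OF p C c])
  then show ?thesis
    using decay_from_horizon[OF p K damping C c ext r] by (simp add: C_def)
qed

text \<open>By \<open>Z_bound\<close>, |Z| at R is at most rp |Y| on the horizon plus H v^(-3 -
  epsilon/2). After squaring, the first part is dominated by the horizon flux and the second
  contributes v^5 v^(-6 - epsilon), whose integral is finite.\<close>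

lemma outgoing_flux_bound:
  assumes \<epsilon>: "0 < \<epsilon>" and A: "0 \<le> A" and R: "rp \<le> R"
    and flux: "(\<integral>\<^sup>+v\<in>{1..}. ennreal (v powr (7 + \<epsilon>) * (d_v_at M e \<phi> v rp)\<^sup>2) \<partial>lborel) \<le> ennreal A"
    and decay: "\<And>v r. (v, r) \<in> ext \<Longrightarrow> r \<le> R \<Longrightarrow> \<bar>\<phi> (v, r)\<bar> \<le> B * v powr - (3 + \<epsilon> / 2)"
  shows "(\<integral>\<^sup>+v\<in>{v. (v, R) \<in> ext}. ennreal (v ^ 5 * (d_v_at M e (times_r \<phi>) v R)\<^sup>2) \<partial>lborel)
    \<le> ennreal (2 * rp\<^sup>2 * A + 2 * (2 * M / rp\<^sup>2 * B * (R - rp))\<^sup>2 / \<epsilon>)"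
proof -
  define H where "H = 2 * M / rp\<^sup>2 * B * (R - rp)"
  define f where "f v = v powr (7 + \<epsilon>) * (d_v_at M e \<phi> v rp)\<^sup>2" for v
  have pointwise: "v ^ 5 * (d_v_at M e (times_r \<phi>) v R)\<^sup>2 \<le> 2 * rp\<^sup>2 * f v + 2 * H\<^sup>2 * v powr (- 1 - \<epsilon>)"
    if ext: "(v, R) \<in> ext" for v
  proof -
    have v: "1 \<le> v" using ext by (simp add: ext_def)
    define q where "q = v powr - (3 + \<epsilon> / 2)"
    have "\<bar>Z v R\<bar> \<le> rp * \<bar>Y v rp\<bar> + 2 * M / rp\<^sup>2 * (B * q) * (R - rp)"
      unfolding q_def by (intro Z_bound[OF ext] decay ext_slice[OF ext])
    also have "\<dots> = rp * \<bar>Y v rp\<bar> + H * q" by (simp add: H_def)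
    finally have "\<bar>Z v R\<bar>\<^sup>2 \<le> (rp * \<bar>Y v rp\<bar> + H * q)\<^sup>2" by (intro power_mono) auto
    also have "\<dots> \<le> 2 * (rp * \<bar>Y v rp\<bar>)\<^sup>2 + 2 * (H * q)\<^sup>2"
      using zero_le_power2[of "rp * \<bar>Y v rp\<bar> - H * q"] unfolding power2_sum power2_diff by linarith
    finally have "v ^ 5 * (Z v R)\<^sup>2 \<le> v ^ 5 * (2 * (rp * \<bar>Y v rp\<bar>)\<^sup>2 + 2 * (H * q)\<^sup>2)"
      using v by (intro mult_left_mono) auto
    also have "\<dots> = 2 * rp\<^sup>2 * (v ^ 5 * (Y v rp)\<^sup>2) + 2 * H\<^sup>2 * (v ^ 5 * q\<^sup>2)"
      by (simp add: power_mult_distrib algebra_simps)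
    also have "v ^ 5 * q\<^sup>2 = v powr (- 1 - \<epsilon>)"
    proof -
      have "v ^ 5 * q\<^sup>2 = v powr 5 * (q * q)" using v by (simp add: powr_numeral power2_eq_square)
      also have "\<dots> = v powr (- 1 - \<epsilon>)" by (simp add: q_def powr_add[symmetric])
      finally show ?thesis .
    qed
    also have "2 * rp\<^sup>2 * (v ^ 5 * (Y v rp)\<^sup>2) + 2 * H\<^sup>2 * v powr (- 1 - \<epsilon>)
        \<le> 2 * rp\<^sup>2 * f v + 2 * H\<^sup>2 * v powr (- 1 - \<epsilon>)"
    proof (intro add_right_mono mult_left_mono)
      have "v ^ 5 = v powr 5" using v by (simp add: powr_numeral)
      also have "\<dots> \<le> v powr (7 + \<epsilon>)" using v \<epsilon> by (intro powr_mono) auto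
      finally show "v ^ 5 * (Y v rp)\<^sup>2 \<le> f v"
        unfolding f_def d_v_at_horizon[OF v] by (intro mult_right_mono) auto
    qed simp
    finally show ?thesis by (simp add: d_v_at_times_r[OF ext])
  qed
  \<comment> \<open>On v >= 1 the limit hidden in \<open>d_v_at\<close> is the continuous function
    Y, which is why \<open>f\<close> is measurable there.\<close>
  have f_measurable: "(\<lambda>v. ennreal (f v) * indicator {1..} v) \<in> borel_measurable lborel"
  proof -
    have "continuous_on {1..} (\<lambda>v. v powr (7 + \<epsilon>) * (Y v rp)\<^sup>2)"
      using horizon_in_ext by (intro continuous_intros) auto
    then have "continuous_on {1..} f"
      by (rule continuous_on_eq) (auto simp: f_def d_v_at_horizon)
    then have "(\<lambda>v. indicator {1..} v * f v) \<in> borel_measurable lborel"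
      using borel_measurable_continuous_on_indicator[of "{1..}" f] by simp
    then have "(\<lambda>v. ennreal (indicator {1..} v * f v)) \<in> borel_measurable lborel" by measurable
    then show ?thesis
      by (rule measurable_cong[THEN iffD1, rotated]) (auto simp: indicator_def)
  qed
  have "(\<integral>\<^sup>+v\<in>{v. (v, R) \<in> ext}. ennreal (v ^ 5 * (d_v_at M e (times_r \<phi>) v R)\<^sup>2) \<partial>lborel)
      \<le> (\<integral>\<^sup>+v. ennreal (2 * rp\<^sup>2) * (ennreal (f v) * indicator {1..} v)
          + ennreal (2 * H\<^sup>2) * (ennreal (v powr (- 1 - \<epsilon>)) * indicator {1..} v) \<partial>lborel)"
  proof (rule nn_integral_mono)
    fix v
    show "ennreal (v ^ 5 * (d_v_at M e (times_r \<phi>) v R)\<^sup>2) * indicator {v. (v, R) \<in> ext} v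
      \<le> ennreal (2 * rp\<^sup>2) * (ennreal (f v) * indicator {1..} v)
          + ennreal (2 * H\<^sup>2) * (ennreal (v powr (- 1 - \<epsilon>)) * indicator {1..} v)"
    proof (cases "(v, R) \<in> ext")
      case True
      then have "1 \<le> v" by (simp add: ext_def)
      moreover have "0 \<le> f v" by (simp add: f_def)
      ultimately show ?thesis
        using True ennreal_leI[OF pointwise[OF True]]
        by (simp add: ennreal_mult'[symmetric] ennreal_plus[symmetric] del: ennreal_plus)
    qed simp
  qed
  also have "\<dots> = ennreal (2 * rp\<^sup>2) * (\<integral>\<^sup>+v\<in>{1..}. ennreal (f v) \<partial>lborel)
      + ennreal (2 * H\<^sup>2) * (\<integral>\<^sup>+v\<in>{1..}. ennreal (v powr (- 1 - \<epsilon>)) \<partial>lborel)"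
    using f_measurable by (simp add: nn_integral_add nn_integral_cmult)
  also have "\<dots> \<le> ennreal (2 * rp\<^sup>2) * ennreal A + ennreal (2 * H\<^sup>2) * ennreal (1 / \<epsilon>)"
    using flux unfolding f_def nn_integral_powr_tail[OF \<epsilon>] by (intro add_mono mult_left_mono) auto
  also have "\<dots> = ennreal (2 * rp\<^sup>2 * A + 2 * H\<^sup>2 / \<epsilon>)"
    using A \<epsilon> by (simp add: ennreal_mult'[symmetric] ennreal_plus[symmetric] del: ennreal_plus)
  finally show ?thesis unfolding H_def .
qed

end

theorem theorem1p8:
  fixes M e U0 A R D \<epsilon> :: real
  assumes "0 < \<bar>e\<bar>" and "\<bar>e\<bar> < M" and "U0 > 0"
    and "D > 0" and "A > 0" and "\<epsilon> > 0" and "R \<ge> r_plus M e"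
  shows "\<exists>C>0. \<forall>\<phi> :: real \<times> real \<Rightarrow> real.
    is_solution M e U0 \<phi> \<longrightarrow>
    data_bounds M e U0 D \<phi> \<longrightarrow>
    (\<integral>\<^sup>+v\<in>{1..}. ennreal (v powr (7 + \<epsilon>) * (d_v_at M e \<phi> v (r_plus M e))\<^sup>2) \<partial>lborel) = ennreal A \<longrightarrow>
      (SUP (v, r) \<in> {(v, r) \<in> region M e U0. r_plus M e \<le> r \<and> r \<le> R}.
         ennreal (v powr (3 + \<epsilon> / 2) * \<bar>\<phi> (v, r)\<bar>)) \<le> ennreal C \<and>
      (\<integral>\<^sup>+v\<in>{v. (v, R) \<in> region M e U0}.
         ennreal (v ^ 5 * (d_v_at M e (times_r \<phi>) v R)\<^sup>2) \<partial>lborel) \<le> ennreal C"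
proof -
  interpret reissner_nordstrom M e
    using assms by unfold_locales auto
  \<comment> \<open>K, B and B' are fixed before phi is introduced, which makes the constant uniform
    over all solutions.\<close>
  obtain K where K: "0 < K" "\<And>r. rp \<le> r \<Longrightarrow> r \<le> R \<Longrightarrow> 2 * ((3 + \<epsilon> / 2) / K) \<le> dF r"
    using red_shift_lower_bound[of "3 + \<epsilon> / 2" R] assms by auto
  define B where "B = decay_const (3 + \<epsilon> / 2) K R ((A + 1 / (6 + \<epsilon>)) / 2) D"
  define B' where "B' = 2 * rp\<^sup>2 * A + 2 * (2 * M / rp\<^sup>2 * B * (R - rp))\<^sup>2 / \<epsilon>"
  show ?thesis
  proof (intro exI[of _ "max 1 (max B B')"] conjI allI impI)
    fix \<phi> :: "real \<times> real \<Rightarrow> real"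
    assume sol: "is_solution M e U0 \<phi>" and data: "data_bounds M e U0 D \<phi>"
      and flux: "(\<integral>\<^sup>+v\<in>{1..}. ennreal (v powr (7 + \<epsilon>) * (d_v_at M e \<phi> v rp)\<^sup>2) \<partial>lborel) = ennreal A"
    obtain \<phi>' where "\<And>p. p \<in> region M e U0 \<Longrightarrow>
        (\<phi> has_derivative blinfun_apply (\<phi>' p)) (at p within region M e U0)"
      and "continuous_on (region M e U0) \<phi>'"
      using sol unfolding is_solution_def C1_on_def by blast
    then interpret exterior_solution_data M e U0 \<phi> \<phi>' D
      using sol data assms by unfold_locales (auto simp: is_solution_def)
    have decay: "\<bar>\<phi> (v, r)\<bar> \<le> B * v powr - (3 + \<epsilon> / 2)" if "(v, r) \<in> ext" "r \<le> R" for v r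
      unfolding B_def using assms K flux that by (intro decay_from_horizon_flux) auto
    show "(SUP (v, r) \<in> {(v, r) \<in> region M e U0. rp \<le> r \<and> r \<le> R}.
         ennreal (v powr (3 + \<epsilon> / 2) * \<bar>\<phi> (v, r)\<bar>)) \<le> ennreal (max 1 (max B B'))"
    proof (rule SUP_least, clarify)
      fix v r assume "(v, r) \<in> region M e U0" "rp \<le> r" "r \<le> R"
      then have ext: "(v, r) \<in> ext" "r \<le> R" by (auto simp: ext_iff)
      then have v: "1 \<le> v" by (simp add: ext_def)
      have "v powr (3 + \<epsilon> / 2) * \<bar>\<phi> (v, r)\<bar> \<le> v powr (3 + \<epsilon> / 2) * (B * v powr - (3 + \<epsilon> / 2))"
        by (intro mult_left_mono decay[OF ext]) simp
      also have "\<dots> = B" using v by (simp add: powr_minus field_simps)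
      finally show "ennreal (v powr (3 + \<epsilon> / 2) * \<bar>\<phi> (v, r)\<bar>) \<le> ennreal (max 1 (max B B'))"
        by (intro ennreal_leI) simp
    qed
    have "{v. (v, R) \<in> region M e U0} = {v. (v, R) \<in> ext}"
      using assms by (auto simp: ext_iff)
    then have "(\<integral>\<^sup>+v\<in>{v. (v, R) \<in> region M e U0}.
         ennreal (v ^ 5 * (d_v_at M e (times_r \<phi>) v R)\<^sup>2) \<partial>lborel) \<le> ennreal B'"
      unfolding B'_def using outgoing_flux_bound[of \<epsilon> A R B] assms flux decay by simp
    also have "\<dots> \<le> ennreal (max 1 (max B B'))" by (intro ennreal_leI) simp
    finally show "(\<integral>\<^sup>+v\<in>{v. (v, R) \<in> region M e U0}.
         ennreal (v ^ 5 * (d_v_at M e (times_r \<phi>) v R)\<^sup>2) \<partial>lborel) \<le> ennreal (max 1 (max B B'))" .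
  qed simp
qed

end
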